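(* Let $n,a,b,t$ be positive integers with $b\geq 2$, $a\geq b+t-1$ and $n\geq \max\{a+b,\,bt\}$. Suppose that $\mathcal{F}\subset \binom{[n]}{a}$ and $\mathcal{G}\subset \binom{[n]}{b}$ are cross-intersecting families with $\tau(\mathcal{F})\geq 1$ and $\tau(\mathcal{G})\geq t$. Then \[ |\mathcal{F}| + |\mathcal{G}| \leq \binom{n}{a} + \sum_{i=1}^t(-1)^i\binom{t}{i}\binom{n-ib}{a} + t. \] Moreover, when $n>a+b$, equality holds if and only if $\mathcal{F}\cup \mathcal{G}$ is isomorphic to $\mathcal{M}^t(n,a,b)$.
   Context: $[n]=\{1,\dots,n\}$ and $\binom{[n]}{k}$ is the family of all $k$-element subsets of $[n]$. Two families $\mathcal{F},\mathcal{G}$ are cross-intersecting if $F\cap G\neq\emptyset$ for all $F\in\mathcal{F}$, $G\in\mathcal{G}$. For a family $\mathcal{F}$ of nonempty subsets of $[n]$, the covering number $\tau(\mathcal{F})$ is the minimum size of a set $T\subset[n]$ with $T\cap F\neq\emptyset$ for all $F\in\mathcal{F}$ (so $\tau(\mathcal{F})\geq 1$ means $\mathcal{F}$ is nonempty). For $n\geq tb$, let $B_1,\dots,B_t\in\binom{[n]}{b}$ be pairwise disjoint and define $\mathcal{M}^t(n,a,b):=\{B_1,\dots,B_t\}\cup\{A\in\binom{[n]}{a}: A\cap B_i\neq\emptyset \text{ for all } 1\le i\le t\}$. "$\mathcal{F}\cup\mathcal{G}$ is isomorphic to $\mathcal{M}$" means there is a permutation of $[n]$ mapping $\mathcal{F}\cup\mathcal{G}$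 onto $\mathcal{M}$.
   Formalization: The equality clause is false as printed when a=b (so t=1): the formal version excludes a=b=2 from it (F=G=a full star of pairs also attains the bound) and, when a=b, requires also that F∩G is nonempty, since the union alone does not determine |F|+|G|. *)

theory Defs
  imports
    Complex_Main
    "HOL-Library.Ramsey"
    "HOL-Library.Disjoint_Sets"
    "HOL-Combinatorics.Permutations"
begin

definition cross_intersecting :: "'a set set \<Rightarrow> 'a set set \<Rightarrow> bool" where
  "cross_intersecting \<F> \<G> \<longleftrightarrow> (\<forall>F\<in>\<F>. \<forall>G\<in>\<G>. F \<inter> G \<noteq> {})"

(* Meaningful only if every member of the family meets {1..n}; then {1..n} is itself a cover
   and Min is taken over a finite nonempty set. The empty family has covering number 0. *)
definition covering_number :: "nat \<Rightarrow> nat set set \<Rightarrow> nat" where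
  "covering_number n \<F> = Min (card ` {T. T \<subseteq> {1..n} \<and> (\<forall>F\<in>\<F>. T \<inter> F \<noteq> {})})"

definition disjoint_blocks :: "nat \<Rightarrow> nat \<Rightarrow> nat \<Rightarrow> (nat \<Rightarrow> nat set) \<Rightarrow> bool" where
  "disjoint_blocks n b t B \<longleftrightarrow>
     (\<forall>i\<in>{1..t}. B i \<in> nsets {1..n} b) \<and> disjoint_family_on B {1..t}"

definition M_family :: "nat \<Rightarrow> nat \<Rightarrow> nat \<Rightarrow> (nat \<Rightarrow> nat set) \<Rightarrow> nat set set" where
  "M_family n a t B = B ` {1..t} \<union> {A \<in> nsets {1..n} a. \<forall>i\<in>{1..t}. A \<inter> B i \<noteq> {}}"

definition isomorphic_families :: "nat \<Rightarrow> nat set set \<Rightarrow> nat set set \<Rightarrow> bool" where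
  "isomorphic_families n \<H> \<K> \<longleftrightarrow> (\<exists>\<pi>. \<pi> permutes {1..n} \<and> (\<lambda>H. \<pi> ` H) ` \<H> = \<K>)"

(* Pitfall for a = b (which forces t = 1 when a >= b + t - 1), with M the family above and
   bound = (n choose b) - (n - b choose b) + 1 = card M + 1:
   the union of F and G does not record the members common to F and G. If G = {B 1} and F
   consists of all b-sets other than B 1 that meet B 1, the union is M, but
   card F + card G = card M. So "union isomorphic to M" gives equality in the bound only
   together with a nonempty intersection of F and G.
   If a = b = 2 and F = G consists of all pairs through a fixed point, then
   card F + card G = 2 * n - 2 = bound, but the union has n - 1 members and M has 2 * n - 3;
   so this pair of parameters is a genuine exception to the characterization of equality. *)

end

theory Submission
  imports Defs
begin

text \<open>
  We may take \<open>\<F>\<close> to be the family of all \<open>a\<close>-sets that meet every member of \<open>\<G>\<close>. Splitting at a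
  point \<open>y\<close> lying in a member of \<open>\<F>\<close> and in a member of \<open>\<G>\<close>, the \<open>a\<close>-sets through \<open>y\<close> need only
  meet the members of \<open>\<G>\<close> missing \<open>y\<close>, a family of covering number at least \<open>t - 1\<close>, to which
  induction on \<open>t\<close> applies. The \<open>a\<close>-sets avoiding \<open>y\<close> must meet the traces on the complement of \<open>y\<close>;
  these have sizes \<open>b - 1\<close> and \<open>b\<close>, and only the \<open>(b - 1)\<close>-sets are still to be counted. Repeating
  the split leads to families with sizes in \<open>[c, b]\<close> of which only the members of size \<open>c\<close> count, and
  there the induction closes. When equality holds, every point of a member of \<open>\<G>\<close> turns out to lie
  in exactly one member, so \<open>\<G>\<close> consists of disjoint sets, and there are \<open>t\<close> of them.

  The induction starts at \<open>t = 1\<close>: if \<open>a > b\<close> a double count of disjoint pairs suffices, and \<open>a = b\<close>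
  is the cross-intersecting Hilton--Milner theorem. The latter is proved by supermodularity of
  \<open>|hitting X a \<S>| + |\<S>|\<close> in \<open>\<S>\<close>: a smallest nontrivial maximizer is almost disjoint from its
  images under transpositions that do not fix it, which leaves only two small configurations.
\<close>

section \<open>Sets hitting a family\<close>

definition hitting :: "'a set \<Rightarrow> nat \<Rightarrow> 'a set set \<Rightarrow> 'a set set" where
  "hitting X a \<H> = {A \<in> nsets X a. \<forall>S\<in>\<H>. A \<inter> S \<noteq> {}}"

text \<open>The covering number is at least \<open>t\<close>, stated without a minimum. A family
  with the member \<open>{}\<close> has no cover and satisfies this for every \<open>t\<close>; such
  families arise once points are deleted from members.\<close>

definition cover_ge :: "nat \<Rightarrow> 'a set set \<Rightarrow> bool" where
  "cover_ge t \<H> \<longleftrightarrow> (\<forall>T. finite T \<and> card T < t \<longrightarrow> (\<exists>S\<in>\<H>. T \<inter> S = {}))"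

text \<open>The number of \<open>a\<close>-subsets of an \<open>m\<close>-set meeting each of \<open>s\<close> disjoint blocks of size \<open>b\<close>, sorted
  by the first point of a block that they contain. Because of truncated subtraction this reading
  needs \<open>s \<le> a\<close> and \<open>s * b \<le> m\<close>.\<close>

primrec hit_count :: "nat \<Rightarrow> nat \<Rightarrow> nat \<Rightarrow> nat \<Rightarrow> nat" where
  "hit_count b 0 m a = m choose a"
| "hit_count b (Suc s) m a = (\<Sum>i=1..b. hit_count b s (m - i) (a - 1))"

text \<open>As above, with one additional block of size \<open>c\<close>.\<close>

definition hit_count1 :: "nat \<Rightarrow> nat \<Rightarrow> nat \<Rightarrow> nat \<Rightarrow> nat \<Rightarrow> nat" where
  "hit_count1 b c s m a = (\<Sum>i=1..c. hit_count b s (m - i) (a - 1))"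

lemma hit_count_Suc: "hit_count b (Suc s) m a = hit_count1 b b s m a"
  by (simp add: hit_count1_def)

lemma hit_count1_0 [simp]: "hit_count1 b 0 s m a = 0"
  by (simp add: hit_count1_def)

text \<open>The first summand counts the sets through the first point of the extra block, the second
  those avoiding it. The recursion matches the one that \<open>card_hitting_split\<close> gives for
  \<open>hitting\<close>.\<close>

lemma hit_count1_Suc:
  "hit_count1 b (Suc c) s m a = hit_count b s (m - 1) (a - 1) + hit_count1 b c s (m - 1) a"
proof -
  have "hit_count1 b (Suc c) s m a = (\<Sum>i\<in>insert 1 {2..Suc c}. hit_count b s (m - i) (a - 1))"
    unfolding hit_count1_def by (rule sum.cong) auto
  also have "\<dots> = hit_count b s (m - 1) (a - 1) + (\<Sum>i=2..Suc c. hit_count b s (m - i) (a - 1))"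
    by (subst sum.insert) auto
  also have "(\<Sum>i=2..Suc c. hit_count b s (m - i) (a - 1))
      = (\<Sum>i=1..c. hit_count b s (m - 1 - i) (a - 1))"
    using sum.shift_bounds_cl_Suc_ivl[of "\<lambda>i. hit_count b s (m - i) (a - 1)" 1 c]
    by (simp add: numeral_2_eq_2)
  finally show ?thesis by (simp add: hit_count1_def)
qed

lemma hit_count1_mono: "c \<le> c' \<Longrightarrow> hit_count1 b c s m a \<le> hit_count1 b c' s m a"
  unfolding hit_count1_def by (intro sum_mono2) auto

text \<open>The summand \<open>i = Suc c\<close> of a full block is still available when
  \<open>c < b\<close>. It is the slack that later absorbs an additive \<open>1\<close>.\<close>

lemma hit_count1_less:
  assumes "c < b"
  shows "hit_count1 b c s m a + hit_count b s (m - Suc c) (a - 1) \<le> hit_count b (Suc s) m a"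
  using hit_count1_mono[of "Suc c" b b s m a] assms
  by (simp add: hit_count1_def hit_count_Suc)

section \<open>Estimates for binomial coefficients and \<open>hit_count\<close>\<close>

lemma binomial_le_binomial:
  fixes k a N :: nat
  assumes "k \<le> a" "a + k \<le> N"
  shows "N choose k \<le> N choose a"
proof (cases "2 * a \<le> N")
  case True
  then show ?thesis using assms by (intro binomial_mono) auto
next
  case False
  \<comment> \<open>Here \<open>a\<close> lies beyond the middle; its mirror image
    \<open>N - a\<close> is still at least \<open>k\<close> and lies in the increasing half.\<close>
  have "N choose k \<le> N choose (N - a)" using assms False by (intro binomial_mono) auto
  then show ?thesis using assms by (simp add: binomial_symmetric[of a N])
qed

lemma binomial_ge_top:
  fixes j N :: nat
  assumes "1 \<le> j" "j < N"
  shows "N \<le> N choose j"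
  using binomial_le_binomial[of 1 j N] assms by simp

lemma binomial_gr_top:
  fixes j N :: nat
  assumes "2 \<le> j" "j + 2 \<le> N"
  shows "N < N choose j"
proof -
  obtain N' j' where N: "N = Suc N'" "j = Suc j'" using assms by (cases N; cases j) auto
  have "N' \<le> N' choose j'" "N' \<le> N' choose j"
    using assms N by (auto intro!: binomial_ge_top simp del: binomial_Suc_Suc)
  then show ?thesis using N assms by simp
qed

lemma hit_count1_single:
  assumes "c \<le> M" "1 \<le> a"
  shows "hit_count1 b c 0 M a + ((M - c) choose a) = M choose a"
  using assms
proof (induction c arbitrary: M)
  case (Suc c)
  obtain M' a' where M: "M = Suc M'" "a = Suc a'" using Suc.prems by (cases M; cases a) auto
  show ?case using Suc.IH[of M'] Suc.prems M by (simp add: hit_count1_Suc)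
qed simp

text \<open>A lower bound for the slack, used with \<open>k = 0\<close> (it is positive) and
  \<open>k = 1\<close> (it is at least \<open>N\<close>). Nothing forces \<open>s\<close> blocks to
  fit into \<open>N\<close> points, so \<open>hit_count\<close> is handled purely through its
  recursion.\<close>

lemma binomial_le_hit_count:
  assumes "k < b" "k + s \<le> a" "a + k \<le> N"
  shows "N choose k \<le> hit_count b s N a"
  using assms
proof (induction s arbitrary: k a N)
  case 0
  then show ?case by (simp add: binomial_le_binomial)
next
  case (Suc s)
  note IH = Suc.IH
  \<comment> \<open>The binomial is the sum of the \<open>Suc k\<close> terms
    \<open>(N - 1 - i) choose (k - i)\<close>, each of which is below one summand of
    \<open>hit_count1\<close>.\<close>
  have "N choose k \<le> hit_count1 b (Suc k) s N a"
    using Suc.prems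
  proof (induction k arbitrary: N)
    case 0
    then show ?case
      using Suc.IH[of 0 "a - 1" "N - 1"] by (simp add: hit_count1_Suc)
  next
    case (Suc k)
    then obtain N' where N: "N = Suc N'" by (cases N) auto
    have "N' choose Suc k \<le> hit_count b s N' (a - 1)"
      using Suc.prems N by (intro IH) auto
    moreover have "N' choose k \<le> hit_count1 b (Suc k) s N' a"
      using Suc.prems N by (intro Suc.IH) auto
    ultimately show ?case using N by (simp add: hit_count1_Suc)
  qed
  also have "\<dots> \<le> hit_count b (Suc s) N a"
    unfolding hit_count_Suc using Suc.prems by (intro hit_count1_mono) auto
  finally show ?case .
qed

section \<open>Deleting a point from the ground set\<close>

lemma card_nsets: "finite X \<Longrightarrow> card (nsets X a) = card X choose a"
proof -
  assume X: "finite X"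
  then have "nsets X a = {N. N \<subseteq> X \<and> card N = a}"
    unfolding nsets_def by (auto intro: finite_subset)
  then show ?thesis using n_subsets[OF X, of a] by simp
qed

lemma finite_hitting: "finite X \<Longrightarrow> finite (hitting X a \<H>)"
  unfolding hitting_def by (simp add: finite_imp_finite_nsets)

lemma hitting_subset: "hitting X a \<H> \<subseteq> nsets X a"
  unfolding hitting_def by auto

lemma hitting_antimono: "\<H> \<subseteq> \<K> \<Longrightarrow> hitting X a \<K> \<subseteq> hitting X a \<H>"
  unfolding hitting_def by auto

text \<open>Adding \<open>y\<close> to a cover of the members missing \<open>y\<close> covers
  everything, at the cost of one point.\<close>

lemma cover_ge_remove:
  assumes "cover_ge (Suc s) \<H>"
  shows "cover_ge s {S \<in> \<H>. y \<notin> S}"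
  unfolding cover_ge_def
proof (intro allI impI)
  fix T :: "'a set" assume T: "finite T \<and> card T < s"
  then have "finite (insert y T)" "card (insert y T) < Suc s"
    by (auto simp: card_insert_if)
  then obtain S where "S \<in> \<H>" "insert y T \<inter> S = {}"
    using assms unfolding cover_ge_def by blast
  then show "\<exists>S\<in>{S \<in> \<H>. y \<notin> S}. T \<inter> S = {}" by auto
qed

lemma cover_ge_shrink:
  assumes "cover_ge s \<H>"
  shows "cover_ge s ((\<lambda>S. S - {y}) ` \<H>)"
  unfolding cover_ge_def
proof (intro allI impI)
  fix T :: "'a set" assume "finite T \<and> card T < s"
  then obtain S where "S \<in> \<H>" "T \<inter> S = {}" using assms unfolding cover_ge_def by blast
  then show "\<exists>S\<in>(\<lambda>S. S - {y}) ` \<H>. T \<inter> S = {}" by auto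
qed

lemma cover_ge_Suc_nonempty: "cover_ge (Suc s) \<H> \<Longrightarrow> \<H> \<noteq> {}"
  unfolding cover_ge_def by (auto dest: spec[of _ "{}"])

text \<open>A set avoiding \<open>y\<close> hits \<open>S\<close> exactly if it hits
  \<open>S - {y}\<close>, and a set through \<open>y\<close> already hits every member through
  \<open>y\<close>. Deletion may identify two members, which does not change what hits them.\<close>

lemma card_hitting_split:
  assumes "finite X" "y \<in> X" "0 < a"
  shows "card (hitting X a \<H>) = card (hitting (X - {y}) a ((\<lambda>S. S - {y}) ` \<H>))
      + card (hitting (X - {y}) (a - 1) {S \<in> \<H>. y \<notin> S})"
proof -
  let ?P = "hitting (X - {y}) a ((\<lambda>S. S - {y}) ` \<H>)"
  let ?Q = "hitting (X - {y}) (a - 1) {S \<in> \<H>. y \<notin> S}"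
  have "hitting X a \<H> = ?P \<union> insert y ` ?Q"
  proof (intro equalityI subsetI)
    fix A assume A: "A \<in> hitting X a \<H>"
    show "A \<in> ?P \<union> insert y ` ?Q"
    proof (cases "y \<in> A")
      case True
      have "A - {y} \<in> ?Q"
      proof -
        have "(A - {y}) \<inter> S \<noteq> {}" if "S \<in> \<H>" "y \<notin> S" for S
          using A that unfolding hitting_def by blast
        then show ?thesis using A True unfolding hitting_def nsets_def by auto
      qed
      moreover have "A = insert y (A - {y})" using True by auto
      ultimately show ?thesis by blast
    next
      case False
      then have "A \<in> ?P" using A unfolding hitting_def nsets_def by blast
      then show ?thesis by simp
    qed
  next
    fix A assume A: "A \<in> ?P \<union> insert y ` ?Q"
    then consider "A \<in> ?P" | A' where "A = insert y A'" "A' \<in> ?Q" by blast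
    then show "A \<in> hitting X a \<H>"
    proof cases
      case 1
      then have "A \<in> nsets X a" and meets: "\<And>S. S \<in> \<H> \<Longrightarrow> A \<inter> (S - {y}) \<noteq> {}"
        unfolding hitting_def nsets_def by auto
      moreover have "A \<inter> S \<noteq> {}" if "S \<in> \<H>" for S
        using meets[OF that] by blast
      ultimately show ?thesis unfolding hitting_def by simp
    next
      case 2
      then have "y \<notin> A'" unfolding hitting_def nsets_def by auto
      then have "A \<in> nsets X a" using 2 assms unfolding hitting_def nsets_def by auto
      moreover have "A \<inter> S \<noteq> {}" if "S \<in> \<H>" for S
        using that 2 unfolding hitting_def by (cases "y \<in> S") auto
      ultimately show ?thesis unfolding hitting_def by simp
    qed
  qed
  moreover have "?P \<inter> insert y ` ?Q = {}" unfolding hitting_def nsets_def by auto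
  moreover have "inj_on (insert y) ?Q"
    unfolding hitting_def nsets_def inj_on_def by blast
  ultimately show ?thesis using assms(1)
    by (simp add: card_Un_disjoint finite_hitting card_image)
qed

text \<open>The points of one member \<open>S0\<close> are split off one after another: a hitting
  set has a first point in \<open>S0\<close>, and it must still hit the members missing that point,
  which have covering number at least \<open>s\<close>.\<close>

lemma card_hitting_le_hit_count:
  assumes "finite X" "\<And>S. S \<in> \<H> \<Longrightarrow> S \<subseteq> X \<and> card S \<le> b" "cover_ge s \<H>"
  shows "card (hitting X a \<H>) \<le> hit_count b s (card X) a"
  using assms
proof (induction s arbitrary: X \<H> a)
  case 0
  show ?case
    using card_mono[OF finite_imp_finite_nsets[OF \<open>finite X\<close>] hitting_subset[of X a \<H>]]
      card_nsets[OF \<open>finite X\<close>, of a] by simp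
next
  case (Suc s)
  note IH = Suc.IH
  obtain S0 where S0: "S0 \<in> \<H>" using cover_ge_Suc_nonempty[OF Suc.prems(3)] by auto
  have *: "card (hitting Y a \<K>) \<le> hit_count1 b c s (card Y) a"
    if "finite Y" "\<And>S. S \<in> \<K> \<Longrightarrow> S \<subseteq> Y \<and> card S \<le> b" "cover_ge (Suc s) \<K>" "S0 \<in> \<K>" "card S0 = c"
    for Y :: "'a set" and \<K> S0 c
    using that
  proof (induction c arbitrary: Y \<K> S0)
    case 0
    then have "S0 = {}" using finite_subset by fastforce
    then have "hitting Y a \<K> = {}" using 0 unfolding hitting_def by auto
    then show ?case by simp
  next
    case (Suc c)
    then obtain y where y: "y \<in> S0" by fastforce
    then have yY: "y \<in> Y" using Suc.prems by auto
    have fS: "finite S" if "S \<in> \<K>" for S using that Suc.prems finite_subset by blast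
    show ?case
    \<comment> \<open>For \<open>a = 0\<close> the term \<open>a - 1\<close> would be truncated, but
      the empty set does not meet \<open>S0\<close>.\<close>
    proof (cases "a = 0")
      case True
      then have "hitting Y a \<K> = {}" using Suc.prems unfolding hitting_def nsets_def by auto
      then show ?thesis by simp
    next
      case False
      have "card (hitting (Y - {y}) a ((\<lambda>S. S - {y}) ` \<K>)) \<le> hit_count1 b c s (card (Y - {y})) a"
      proof (rule Suc.IH)
        show "S \<subseteq> Y - {y} \<and> card S \<le> b" if "S \<in> (\<lambda>S. S - {y}) ` \<K>" for S
          using that Suc.prems(2) fS by (force intro: order_trans[OF card_Diff1_le])
        show "card (S0 - {y}) = c" using y Suc.prems by simp
        show "S0 - {y} \<in> (\<lambda>S. S - {y}) ` \<K>" using Suc.prems by auto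
      qed (use Suc.prems cover_ge_shrink in auto)
      moreover have "card (hitting (Y - {y}) (a - 1) {S \<in> \<K>. y \<notin> S})
          \<le> hit_count b s (card (Y - {y})) (a - 1)"
        using Suc.prems by (intro IH)
          (auto intro: cover_ge_remove)
      ultimately show ?thesis
        using card_hitting_split[of Y y a \<K>] False yY Suc.prems(1)
        by (simp add: hit_count1_Suc card_Diff_singleton)
    qed
  qed
  have "card (hitting X a \<H>) \<le> hit_count1 b (card S0) s (card X) a"
    using *[OF Suc.prems S0 refl] by simp
  also have "\<dots> \<le> hit_count b (Suc s) (card X) a"
    unfolding hit_count_Suc using Suc.prems(2)[OF S0] by (intro hit_count1_mono) auto
  finally show ?case .
qed

section \<open>Double counting of disjoint pairs\<close>

lemma card_disjoint_nsets:
  assumes "finite X" "S \<in> nsets X c"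
  shows "card {A \<in> nsets X a. A \<inter> S = {}} = (card X - c) choose a"
proof -
  have "{A \<in> nsets X a. A \<inter> S = {}} = nsets (X - S) a" unfolding nsets_def by auto
  moreover have "card (X - S) = card X - c"
    using assms unfolding nsets_def by (auto simp: card_Diff_subset)
  ultimately show ?thesis using assms(1) card_nsets[of "X - S" a] by simp
qed

text \<open>The disjointness graph between the c-sets and the a-sets is biregular, and the c-sets have
  the larger degree.\<close>

lemma card_hitting_add_card_le:
  assumes X: "finite X" and P: "\<P> \<subseteq> nsets X c" and ca: "c \<le> a" "a + c \<le> card X"
  shows "card (hitting X a \<P>) + card \<P> \<le> card X choose a"
proof -
  let ?m = "card X"
  let ?N = "nsets X a - hitting X a \<P>"
  have fP: "finite \<P>" using P X finite_imp_finite_nsets finite_subset by blast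
  have fN: "finite ?N" using X finite_imp_finite_nsets by blast
  have "card \<P> * ((?m - c) choose a) = (\<Sum>S\<in>\<P>. card {A \<in> ?N. A \<inter> S = {}})"
  proof -
    have "card {A \<in> ?N. A \<inter> S = {}} = (?m - c) choose a" if "S \<in> \<P>" for S
    proof -
      have "{A \<in> ?N. A \<inter> S = {}} = {A \<in> nsets X a. A \<inter> S = {}}"
        using that unfolding hitting_def by auto
      then show ?thesis using card_disjoint_nsets[OF X, of S c a] that P by auto
    qed
    then show ?thesis by simp
  qed
  also have "\<dots> = (\<Sum>A\<in>?N. card {S \<in> \<P>. A \<inter> S = {}})"
    by (rule sum_multicount_gen) (use fP fN in auto)
  also have "\<dots> \<le> (\<Sum>A\<in>?N. (?m - a) choose c)"
  proof (rule sum_mono)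
    fix A assume A: "A \<in> ?N"
    have "card {S \<in> \<P>. A \<inter> S = {}} \<le> card {S \<in> nsets X c. S \<inter> A = {}}"
      using P X by (intro card_mono) (auto simp: finite_imp_finite_nsets)
    then show "card {S \<in> \<P>. A \<inter> S = {}} \<le> (?m - a) choose c"
      using card_disjoint_nsets[OF X, of A a c] A by simp
  qed
  finally have 1: "card \<P> * ((?m - c) choose a) \<le> card ?N * ((?m - a) choose c)" by simp
  \<comment> \<open>Both sides count the disjoint pairs of a \<open>c\<close>-set and an
    \<open>a\<close>-set. As there are at most as many \<open>c\<close>-sets as
    \<open>a\<close>-sets, each \<open>c\<close>-set lies in at least as many pairs as each
    \<open>a\<close>-set.\<close>
  have "(?m choose c) * ((?m - c) choose a) = (?m choose a) * ((?m - a) choose c)"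
    using choose_mult_lemma[of a "?m - a - c" c] choose_mult_lemma[of c "?m - a - c" a] ca
    by (simp add: add.commute binomial_symmetric[of a "a + c"])
  moreover have "?m choose c \<le> ?m choose a" using ca by (intro binomial_le_binomial)
  ultimately have 2: "(?m - a) choose c \<le> (?m - c) choose a"
  proof -
    assume eq: "(?m choose c) * ((?m - c) choose a) = (?m choose a) * ((?m - a) choose c)"
      and le: "?m choose c \<le> ?m choose a"
    have pos: "0 < ?m choose c" using ca by simp
    have "(?m choose c) * ((?m - a) choose c) \<le> (?m choose c) * ((?m - c) choose a)"
      unfolding eq using le by (rule mult_le_mono1)
    then show ?thesis using pos by simp
  qed
  have "card \<P> * ((?m - c) choose a) \<le> card ?N * ((?m - c) choose a)"
    using 1 2 by (meson le_trans mult_le_mono2)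
  moreover have "0 < (?m - c) choose a" using ca by (simp add: zero_less_binomial_iff)
  ultimately have "card \<P> \<le> card ?N" by simp
  then show ?thesis
    using card_Diff_subset[OF finite_hitting[OF X] hitting_subset, of a \<P>] card_nsets[OF X, of a]
      card_mono[OF finite_imp_finite_nsets[OF X] hitting_subset[of X a \<P>]] by simp
qed

section \<open>Counting only the smallest members\<close>

definition sized :: "'a set \<Rightarrow> nat \<Rightarrow> nat \<Rightarrow> 'a set set \<Rightarrow> bool" where
  "sized X c b \<H> \<longleftrightarrow> (\<forall>S\<in>\<H>. S \<subseteq> X \<and> c \<le> card S \<and> card S \<le> b)"

lemma sized_shrink:
  assumes "finite X" "sized X (Suc c) b \<H>"
  shows "sized (X - {y}) c b ((\<lambda>S. S - {y}) ` \<H>)"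
  unfolding sized_def
proof
  fix S' assume "S' \<in> (\<lambda>S. S - {y}) ` \<H>"
  then obtain S where S: "S \<in> \<H>" "S' = S - {y}" by auto
  then have "S \<subseteq> X" "Suc c \<le> card S" "card S \<le> b" using assms(2) unfolding sized_def by auto
  moreover have "finite S" using assms(1) \<open>S \<subseteq> X\<close> finite_subset by auto
  ultimately show "S' \<subseteq> X - {y} \<and> c \<le> card S' \<and> card S' \<le> b"
    using S by (auto simp: card_Diff_singleton_if)
qed

lemma sized_remove: "sized X c b \<H> \<Longrightarrow> sized (X - {y}) c b {S \<in> \<H>. y \<notin> S}"
  unfolding sized_def by auto

lemma sized_finite: "finite X \<Longrightarrow> sized X c b \<H> \<Longrightarrow> finite \<H>"
  unfolding sized_def by (metis PowI finite_Pow_iff finite_subset subsetI)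

text \<open>Members have size at least \<open>Suc c\<close>, so one of size \<open>c\<close> after
  deletion came from a member of size exactly \<open>Suc c\<close> through \<open>y\<close>; on
  members through \<open>y\<close> deletion is injective.\<close>

lemma card_shrink_layer:
  assumes "finite X" "sized X (Suc c) b \<H>"
  shows "card {S \<in> (\<lambda>S. S - {y}) ` \<H>. card S = c} = card {S \<in> \<H>. card S = Suc c \<and> y \<in> S}"
proof -
  have fin: "finite S" and ge: "Suc c \<le> card S" if "S \<in> \<H>" for S
    using assms that finite_subset unfolding sized_def by blast+
  have "{S \<in> (\<lambda>S. S - {y}) ` \<H>. card S = c} = (\<lambda>S. S - {y}) ` {S \<in> \<H>. card S = Suc c \<and> y \<in> S}"
  proof (intro equalityI subsetI)
    fix S' assume "S' \<in> {S \<in> (\<lambda>S. S - {y}) ` \<H>. card S = c}"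
    then obtain S where S: "S \<in> \<H>" "S' = S - {y}" "card (S - {y}) = c" by auto
    then have "y \<in> S" "card S = Suc c"
      using fin[OF S(1)] ge[OF S(1)] by (auto simp: card_Diff_singleton_if split: if_splits)
    then show "S' \<in> (\<lambda>S. S - {y}) ` {S \<in> \<H>. card S = Suc c \<and> y \<in> S}" using S by auto
  qed auto
  moreover have "inj_on (\<lambda>S. S - {y}) {S \<in> \<H>. card S = Suc c \<and> y \<in> S}"
    unfolding inj_on_def by blast
  ultimately show ?thesis by (simp add: card_image)
qed

lemma card_layer_split:
  assumes "finite X" "sized X c b \<H>"
  shows "card {S \<in> \<H>. card S = k} =
    card {S \<in> \<H>. card S = k \<and> y \<in> S} + card {S \<in> {S \<in> \<H>. y \<notin> S}. card S = k}"
proof -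
  have "{S \<in> \<H>. card S = k} = {S \<in> \<H>. card S = k \<and> y \<in> S} \<union> {S \<in> {S \<in> \<H>. y \<notin> S}. card S = k}"
    by auto
  moreover have "finite \<H>" using assms sized_finite by auto
  ultimately show ?thesis by (simp add: card_Un_disjoint disjoint_iff)
qed

text \<open>The layer of smallest members splits along with the hitting sets, so their sum can be
  compared with the recursion \<open>hit_count1_Suc\<close>.\<close>

lemma hitting_layer_split:
  assumes "finite X" "sized X (Suc c) b \<H>" "y \<in> X" "0 < a"
  shows "card (hitting X a \<H>) + card {S \<in> \<H>. card S = Suc c} =
    (card (hitting (X - {y}) a ((\<lambda>S. S - {y}) ` \<H>)) + card {S \<in> (\<lambda>S. S - {y}) ` \<H>. card S = c})
    + (card (hitting (X - {y}) (a - 1) {S \<in> \<H>. y \<notin> S})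
      + card {S \<in> {S \<in> \<H>. y \<notin> S}. card S = Suc c})"
  using card_hitting_split[OF assms(1,3,4), of \<H>] card_shrink_layer[OF assms(1,2), of y]
    card_layer_split[OF assms(1,2), of "Suc c" y]
  by simp

text \<open>Treats the members missing the split point. For \<open>s = 0\<close> double counting
  suffices; otherwise the excess \<open>1\<close> in \<open>step\<close> is absorbed by the slack
  from \<open>hit_count1_less\<close>. Stating \<open>step\<close> as a hypothesis allows it to be
  the induction hypothesis of \<open>hitting_layer_le\<close> or that lemma itself.\<close>

lemma hitting_layer_remove_le:
  assumes "finite X" "sized X c b \<H>" "cover_ge s \<H>" "c < b" "c + s \<le> a" "a + c \<le> card X"
    and step: "\<And>s'. \<lbrakk>s = Suc s'; \<exists>S\<in>\<H>. card S = c\<rbrakk> \<Longrightarrow>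
      card (hitting X a \<H>) + card {S \<in> \<H>. card S = c} \<le> hit_count1 b c s' (card X) a + 1"
  shows "card (hitting X a \<H>) + card {S \<in> \<H>. card S = c} \<le> hit_count b s (card X) a"
proof (cases "{S \<in> \<H>. card S = c} = {}")
  case True
  then have "card {S \<in> \<H>. card S = c} = 0" by (metis card.empty)
  then show ?thesis
    using card_hitting_le_hit_count[of X \<H> b s a] assms(1-3) unfolding sized_def by simp
next
  case False
  show ?thesis
  proof (cases s)
    case 0
    have "{S \<in> \<H>. card S = c} \<subseteq> nsets X c"
      using assms(1,2) finite_subset unfolding sized_def nsets_def by blast
    then have "card (hitting X a {S \<in> \<H>. card S = c}) + card {S \<in> \<H>. card S = c} \<le> card X choose a"
      using assms 0 by (intro card_hitting_add_card_le) auto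
    moreover have "card (hitting X a \<H>) \<le> card (hitting X a {S \<in> \<H>. card S = c})"
      using assms(1) by (intro card_mono finite_hitting hitting_antimono) auto
    ultimately show ?thesis using 0 by simp
  next
    case (Suc s')
    have "1 \<le> hit_count b s' (card X - Suc c) (a - 1)"
      using binomial_le_hit_count[of 0 b s' "a - 1" "card X - Suc c"] assms Suc by simp
    moreover have ex: "\<exists>S\<in>\<H>. card S = c" using False by auto
    ultimately show ?thesis
      using step[OF Suc ex] hit_count1_less[OF \<open>c < b\<close>, of s' "card X" a] unfolding Suc by linarith
  qed
qed

text \<open>Splitting along the points of a smallest member \<open>S0\<close> reduces
  \<open>c\<close> to \<open>0\<close>. There \<open>S0\<close> is empty, nothing hits the family,
  and the smallest layer is \<open>{}\<close> alone: this is the origin of the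
  \<open>+ 1\<close>.\<close>

lemma hitting_layer_le:
  assumes "finite X" "sized X c b \<H>" "cover_ge (Suc s) \<H>" "\<exists>S\<in>\<H>. card S = c"
    and "c < b" "c + Suc s \<le> a" "a + c \<le> card X"
  shows "card (hitting X a \<H>) + card {S \<in> \<H>. card S = c} \<le> hit_count1 b c s (card X) a + 1"
  using assms
\<comment> \<open>Both branches have one point fewer, whereas \<open>c\<close> decreases in only one
  of them and \<open>s\<close> only in the other.\<close>
proof (induction "card X" arbitrary: X c \<H> s a rule: less_induct)
  case less
  obtain S0 where S0: "S0 \<in> \<H>" "card S0 = c" using less.prems by auto
  have S0X: "S0 \<subseteq> X" using S0 less.prems unfolding sized_def by auto
  show ?case
  proof (cases c)
    case 0
    have "S0 = {}" using 0 S0 S0X less.prems(1) finite_subset by fastforce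
    then have "hitting X a \<H> = {}" using S0 unfolding hitting_def by auto
    moreover have "{S \<in> \<H>. card S = c} \<subseteq> {{}}"
      using 0 less.prems(1,2) finite_subset unfolding sized_def by fastforce
    then have "card {S \<in> \<H>. card S = c} \<le> 1"
      using card_mono[of "{{}}" "{S \<in> \<H>. card S = c}"] by simp
    ultimately show ?thesis by simp
  next
    case (Suc c')
    then obtain y where y: "y \<in> S0" using S0 by fastforce
    then have yX: "y \<in> X" using S0X by auto
    let ?Y = "X - {y}"
    have lt: "card ?Y < card X" using yX less.prems(1) by (rule card_Diff1_less[rotated])
    have cY: "card ?Y = card X - 1" and fY: "finite ?Y" using yX less.prems(1) by simp_all
    have sz: "sized X (Suc c') b \<H>" using less.prems Suc by simp
    have "card (hitting ?Y a ((\<lambda>S. S - {y}) ` \<H>)) + card {S \<in> (\<lambda>S. S - {y}) ` \<H>. card S = c'}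
        \<le> hit_count1 b c' s (card ?Y) a + 1"
    proof (rule less.hyps[OF lt fY])
      show "sized ?Y c' b ((\<lambda>S. S - {y}) ` \<H>)" using sized_shrink[OF less.prems(1) sz] .
      show "\<exists>S\<in>(\<lambda>S. S - {y}) ` \<H>. card S = c'" using S0 y Suc by (auto intro!: bexI[of _ S0])
    qed (use less.prems Suc cY in \<open>auto intro: cover_ge_shrink\<close>)
    moreover have "card (hitting ?Y (a - 1) {S \<in> \<H>. y \<notin> S})
        + card {S \<in> {S \<in> \<H>. y \<notin> S}. card S = c} \<le> hit_count b s (card ?Y) (a - 1)"
    proof (rule hitting_layer_remove_le[OF fY])
      show "sized ?Y c b {S \<in> \<H>. y \<notin> S}" by (rule sized_remove[OF less.prems(2)])
      show cov: "cover_ge s {S \<in> \<H>. y \<notin> S}" by (rule cover_ge_remove[OF less.prems(3)])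
      show "card (hitting ?Y (a - 1) {S \<in> \<H>. y \<notin> S}) + card {S \<in> {S \<in> \<H>. y \<notin> S}. card S = c}
          \<le> hit_count1 b c s' (card ?Y) (a - 1) + 1"
        if "s = Suc s'" "\<exists>S\<in>{S \<in> \<H>. y \<notin> S}. card S = c" for s'
      proof (rule less.hyps[OF lt fY])
        show "sized ?Y c b {S \<in> \<H>. y \<notin> S}" by (rule sized_remove[OF less.prems(2)])
        show "cover_ge (Suc s') {S \<in> \<H>. y \<notin> S}" using cov that by simp
      qed (use that less.prems cY in auto)
    qed (use less.prems cY in auto)
    ultimately show ?thesis
      using hitting_layer_split[OF less.prems(1) sz yX, of a] less.prems(6) Suc cY
      by (simp add: hit_count1_Suc)
  qed
qed

text \<open>Two smallest members cannot both follow the split down to size \<open>0\<close>, where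
  they would coincide. So at some point one of them misses the split point, and a slack of at least
  \<open>2\<close> in that branch saves one unit.\<close>

lemma hitting_layer_less:
  assumes "finite X" "sized X c b \<H>" "cover_ge (Suc s) \<H>" "2 \<le> card {S \<in> \<H>. card S = c}"
    and "c < b" "c + Suc s \<le> a" "a + c < card X" "s = 0 \<Longrightarrow> c + 2 \<le> a"
  shows "card (hitting X a \<H>) + card {S \<in> \<H>. card S = c} \<le> hit_count1 b c s (card X) a"
  using assms
proof (induction c arbitrary: X \<H>)
  case 0
  then have "{S \<in> \<H>. card S = 0} \<subseteq> {{}}"
    using finite_subset unfolding sized_def by fastforce
  then have "card {S \<in> \<H>. card S = 0} \<le> 1"
    using card_mono[of "{{}}" "{S \<in> \<H>. card S = 0}"] by simp
  then show ?case using 0 by simp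
next
  case (Suc c)
  let ?L = "{S \<in> \<H>. card S = Suc c}"
  have fH: "finite \<H>" using Suc.prems sized_finite by blast
  obtain y where "y \<in> \<Union>?L"
    and two: "2 \<le> card {S \<in> \<H>. card S = Suc c \<and> y \<in> S} \<or> {S \<in> {S \<in> \<H>. y \<notin> S}. card S = Suc c} \<noteq> {}"
  proof -
    obtain S0 where S0: "S0 \<in> ?L" using Suc.prems(4) by (metis (no_types, lifting) card.empty ex_in_conv not_numeral_le_zero)
    then obtain y where y: "y \<in> S0" by fastforce
    show ?thesis
    proof (cases "{S \<in> {S \<in> \<H>. y \<notin> S}. card S = Suc c} = {}")
      case True
      then have "{S \<in> \<H>. card S = Suc c \<and> y \<in> S} = ?L" by auto
      then show ?thesis using that[of y] S0 y Suc.prems(4) by auto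
    next
      case False
      then show ?thesis using that[of y] S0 y by blast
    qed
  qed
  then obtain S0 where S0: "S0 \<in> \<H>" "card S0 = Suc c" "y \<in> S0" by auto
  then have yX: "y \<in> X" using Suc.prems(2) unfolding sized_def by auto
  let ?Y = "X - {y}" and ?P = "(\<lambda>S. S - {y}) ` \<H>" and ?Q = "{S \<in> \<H>. y \<notin> S}"
  have cY: "card ?Y = card X - 1" and fY: "finite ?Y"
    using yX Suc.prems(1) by auto
  have szP: "sized ?Y c b ?P" and szQ: "sized ?Y (Suc c) b ?Q"
    using sized_shrink[OF Suc.prems(1,2)] sized_remove[OF Suc.prems(2)] by auto
  have covP: "cover_ge (Suc s) ?P" and covQ: "cover_ge s ?Q"
    using Suc.prems(3) by (auto intro: cover_ge_shrink cover_ge_remove)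
  have P: "card (hitting ?Y a ?P) + card {S \<in> ?P. card S = c} \<le> hit_count1 b c s (card ?Y) a + 1"
  proof (rule hitting_layer_le[OF fY szP covP])
    show "\<exists>S\<in>?P. card S = c" using S0 by (auto intro!: bexI[of _ S0])
  qed (use Suc.prems cY in auto)
  have Q: "card (hitting ?Y (a - 1) ?Q) + card {S \<in> ?Q. card S = Suc c} \<le> hit_count b s (card ?Y) (a - 1)"
  proof (rule hitting_layer_remove_le[OF fY szQ covQ])
    show "card (hitting ?Y (a - 1) ?Q) + card {S \<in> ?Q. card S = Suc c}
        \<le> hit_count1 b (Suc c) s' (card ?Y) (a - 1) + 1"
      if "s = Suc s'" "\<exists>S\<in>?Q. card S = Suc c" for s'
      using that covQ Suc.prems cY by (intro hitting_layer_le[OF fY szQ]) auto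
  qed (use Suc.prems cY in auto)
  have "card (hitting ?Y a ?P) + card {S \<in> ?P. card S = c}
      + (card (hitting ?Y (a - 1) ?Q) + card {S \<in> ?Q. card S = Suc c})
      \<le> hit_count1 b c s (card ?Y) a + hit_count b s (card ?Y) (a - 1)"
    using two
  proof
    assume "2 \<le> card {S \<in> \<H>. card S = Suc c \<and> y \<in> S}"
    then have "card (hitting ?Y a ?P) + card {S \<in> ?P. card S = c} \<le> hit_count1 b c s (card ?Y) a"
      using Suc.prems cY card_shrink_layer[OF Suc.prems(1,2), of y]
      by (intro Suc.IH[OF fY szP covP]) auto
    then show ?thesis using Q by linarith
  next
    assume ne: "{S \<in> ?Q. card S = Suc c} \<noteq> {}"
    then have ex: "\<exists>S\<in>?Q. card S = Suc c" by auto
    have "card (hitting ?Y (a - 1) ?Q) + card {S \<in> ?Q. card S = Suc c} + 1 \<le> hit_count b s (card ?Y) (a - 1)"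
    proof (cases s)
      case 0
      \<comment> \<open>For \<open>s = 0\<close> the covering condition says nothing about
        \<open>?Q\<close>, but being nonempty it has covering number at least \<open>1\<close>. The
        extra assumption for \<open>s = 0\<close> makes \<open>hitting_layer_le\<close> applicable
        with \<open>a - 1\<close>.\<close>
      have "cover_ge (Suc 0) ?Q"
        using ex unfolding cover_ge_def by auto
      then have "card (hitting ?Y (a - 1) ?Q) + card {S \<in> ?Q. card S = Suc c}
          \<le> hit_count1 b (Suc c) 0 (card ?Y) (a - 1) + 1"
        using Suc.prems cY 0 by (intro hitting_layer_le[OF fY szQ _ ex]) auto
      moreover have "hit_count1 b (Suc c) 0 (card ?Y) (a - 1) + ((card ?Y - Suc c) choose (a - 1))
          = card ?Y choose (a - 1)"
        using Suc.prems cY 0 by (intro hit_count1_single) auto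
      moreover have "card ?Y - Suc c \<le> (card ?Y - Suc c) choose (a - 1)"
        using Suc.prems cY 0 by (intro binomial_ge_top) auto
      moreover have "2 \<le> card ?Y - Suc c" using Suc.prems cY 0 by auto
      ultimately show ?thesis using 0 by simp
    next
      case (Suc s')
      have "card (hitting ?Y (a - 1) ?Q) + card {S \<in> ?Q. card S = Suc c}
          \<le> hit_count1 b (Suc c) s' (card ?Y) (a - 1) + 1"
        using covQ Suc.prems cY Suc by (intro hitting_layer_le[OF fY szQ _ ex]) auto
      moreover have "(card ?Y - Suc (Suc c)) choose 1 \<le> hit_count b s' (card ?Y - Suc (Suc c)) (a - 1 - 1)"
        using Suc.prems cY Suc by (intro binomial_le_hit_count) auto
      moreover have "2 \<le> card ?Y - Suc (Suc c)" using Suc.prems cY Suc by auto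
      ultimately show ?thesis
        using hit_count1_less[OF Suc.prems(5), of s' "card ?Y" "a - 1"] Suc by simp
    qed
    then show ?thesis using P by linarith
  qed
  then show ?case
    using hitting_layer_split[OF Suc.prems(1,2) yX, of a] Suc.prems(6) cY
    by (simp add: hit_count1_Suc)
qed

section \<open>Equal uniformities\<close>

definition pair_size :: "'a set \<Rightarrow> nat \<Rightarrow> 'a set set \<Rightarrow> nat" where
  "pair_size X a \<S> = card (hitting X a \<S>) + card \<S>"

text \<open>Hitting a union means hitting both families, while a set hitting either family also hits
  the intersection.\<close>

lemma pair_size_supermodular:
  assumes "finite X" "finite \<S>" "finite \<T>"
  shows "pair_size X a \<S> + pair_size X a \<T> \<le> pair_size X a (\<S> \<inter> \<T>) + pair_size X a (\<S> \<union> \<T>)"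
proof -
  have un: "hitting X a (\<S> \<union> \<T>) = hitting X a \<S> \<inter> hitting X a \<T>"
    unfolding hitting_def by auto
  have "hitting X a \<S> \<union> hitting X a \<T> \<subseteq> hitting X a (\<S> \<inter> \<T>)"
    unfolding hitting_def by auto
  then have "card (hitting X a \<S> \<union> hitting X a \<T>) \<le> card (hitting X a (\<S> \<inter> \<T>))"
    using assms(1) by (intro card_mono finite_hitting)
  moreover have "card (hitting X a \<S>) + card (hitting X a \<T>)
      = card (hitting X a \<S> \<union> hitting X a \<T>) + card (hitting X a (\<S> \<union> \<T>))"
    unfolding un using assms(1) by (intro card_Un_Int finite_hitting)
  moreover have "card \<S> + card \<T> = card (\<S> \<union> \<T>) + card (\<S> \<inter> \<T>)"
    using assms by (intro card_Un_Int)
  ultimately show ?thesis unfolding pair_size_def by linarith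
qed

section \<open>Behaviour under permutations, and elementary counts\<close>

lemma nsets_image_permutes:
  assumes "\<pi> permutes X" "A \<in> nsets X a"
  shows "\<pi> ` A \<in> nsets X a"
proof -
  have A: "A \<subseteq> X" "finite A" "card A = a" using assms(2) unfolding nsets_def by auto
  have "\<pi> ` A \<subseteq> X" using A permutes_image[OF assms(1)] by blast
  moreover have "card (\<pi> ` A) = a" using A permutes_inj_on[OF assms(1)] by (simp add: card_image)
  ultimately show ?thesis using A unfolding nsets_def by simp
qed

lemma hitting_image_permutes:
  assumes "\<pi> permutes X"
  shows "hitting X a ((`) \<pi> ` \<S>) = (`) \<pi> ` hitting X a \<S>"
proof (intro equalityI subsetI)
  fix A assume A: "A \<in> hitting X a ((`) \<pi> ` \<S>)"
  let ?A = "inv \<pi> ` A"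
  have eq: "\<pi> ` ?A = A" using permutes_surj[OF assms] by (simp add: image_f_inv_f)
  have "?A \<in> nsets X a"
    using A nsets_image_permutes[OF permutes_inv[OF assms]] unfolding hitting_def by auto
  moreover have "?A \<inter> S \<noteq> {}" if "S \<in> \<S>" for S
  proof -
    have "\<pi> ` ?A \<inter> \<pi> ` S \<noteq> {}" using A that eq unfolding hitting_def by auto
    then show ?thesis using permutes_inj[OF assms] by (auto simp: inj_def)
  qed
  ultimately have "?A \<in> hitting X a \<S>" unfolding hitting_def by auto
  then show "A \<in> (`) \<pi> ` hitting X a \<S>" using eq by blast
next
  fix A assume "A \<in> (`) \<pi> ` hitting X a \<S>"
  then obtain A' where A': "A = \<pi> ` A'" "A' \<in> hitting X a \<S>" by auto
  then have "A \<in> nsets X a" using nsets_image_permutes[OF assms] unfolding hitting_def by auto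
  moreover have "A \<inter> \<pi> ` S \<noteq> {}" if "S \<in> \<S>" for S
    using A' that unfolding hitting_def by fastforce
  ultimately show "A \<in> hitting X a ((`) \<pi> ` \<S>)" unfolding hitting_def by auto
qed

lemma card_image_permutes:
  assumes "\<pi> permutes X"
  shows "card ((`) \<pi> ` \<S>) = card \<S>"
  using permutes_inj[OF assms] by (intro card_image inj_onI) (simp add: inj_image_eq_iff)

lemma card_hitting_avoid:
  assumes "finite X" "\<D> \<subseteq> nsets X a" "hitting X a \<S> \<inter> \<D> = {}"
  shows "card (hitting X a \<S>) + card \<D> \<le> card X choose a"
proof -
  have "finite \<D>" using assms finite_imp_finite_nsets finite_subset by blast
  then have "card (hitting X a \<S>) + card \<D> = card (hitting X a \<S> \<union> \<D>)"
    using assms by (simp add: card_Un_disjoint finite_hitting)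
  also have "\<dots> \<le> card (nsets X a)"
    using assms hitting_subset[of X a \<S>] by (intro card_mono finite_imp_finite_nsets) auto
  finally show ?thesis using card_nsets[OF assms(1)] by simp
qed

lemma hitting_singleton_card:
  assumes "finite X" "B \<in> nsets X b"
  shows "card (hitting X a {B}) + ((card X - b) choose a) = card X choose a"
proof -
  have "nsets X a = hitting X a {B} \<union> {A \<in> nsets X a. A \<inter> B = {}}"
    unfolding hitting_def by auto
  moreover have "hitting X a {B} \<inter> {A \<in> nsets X a. A \<inter> B = {}} = {}"
    unfolding hitting_def by auto
  ultimately have "card (nsets X a) = card (hitting X a {B}) + card {A \<in> nsets X a. A \<inter> B = {}}"
    using assms(1) by (metis (no_types, lifting) card_Un_disjoint finite_Un finite_imp_finite_nsets)
  then show ?thesis using card_disjoint_nsets[OF assms] card_nsets[OF assms(1)] by simp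
qed

text \<open>As long as \<open>B\<close> and \<open>C\<close> differ, a point of \<open>B - C\<close>
  can be exchanged for one of \<open>C - B\<close>, both in \<open>K\<close>; each time
  \<open>B - C\<close> loses a point.\<close>

lemma exchange_closed:
  assumes cl: "\<And>x y B. \<lbrakk>x \<in> K; y \<in> K; B \<in> \<S>; x \<in> B; y \<notin> B\<rbrakk> \<Longrightarrow> insert y (B - {x}) \<in> \<S>"
    and "B \<in> \<S>" "finite B" "finite C" "C - K = B - K" "card (C \<inter> K) = card (B \<inter> K)"
  shows "C \<in> \<S>"
  using assms(2-)
proof (induction "card (B - C)" arbitrary: B rule: less_induct)
  case less
  show ?case
  proof (cases "B \<subseteq> C")
    case True
    have "B \<inter> K = C \<inter> K"
      using True less.prems by (intro card_subset_eq) auto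
    then have "B = C" using less.prems by blast
    then show ?thesis using less.prems by simp
  next
    case False
    then obtain x where x: "x \<in> B" "x \<notin> C" by auto
    then have xK: "x \<in> K" using less.prems by auto
    have "\<not> C \<inter> K \<subseteq> B \<inter> K"
    proof
      assume "C \<inter> K \<subseteq> B \<inter> K"
      then have "C \<inter> K = B \<inter> K" using less.prems by (intro card_subset_eq) auto
      then show False using x xK by auto
    qed
    then obtain y where y: "y \<in> C" "y \<in> K" "y \<notin> B" by auto
    let ?B = "insert y (B - {x})"
    have "B - C = insert x (?B - C)" using x y by auto
    then have "card (?B - C) < card (B - C)"
      using x y less.prems(2) by (auto simp: card_insert_if)
    moreover have "?B \<in> \<S>" using cl[OF xK y(2) less.prems(1) x(1) y(3)] .
    moreover have "C - K = ?B - K" using less.prems x y xK by auto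
    moreover have "card (C \<inter> K) = card (?B \<inter> K)"
    proof -
      have "?B \<inter> K = insert y (B \<inter> K - {x})" using y by auto
      then have "card (?B \<inter> K) = Suc (card (B \<inter> K - {x}))" using y less.prems(2) by simp
      also have "\<dots> = card (B \<inter> K)" using x xK less.prems(2) by (intro card_Suc_Diff1) auto
      finally show ?thesis using less.prems by simp
    qed
    ultimately show ?thesis using less.hyps[of ?B] less.prems by simp
  qed
qed

section \<open>The two exceptional configurations\<close>

text \<open>A sunflower with kernel \<open>L\<close> and one-point petals. No
  \<open>a\<close>-subset of \<open>K\<close> hits it, and these exceed
  \<open>(card X - a) choose a\<close> in number by \<open>(card X - a) choose (a - 1)\<close>,
  which pays for all petals but one. For \<open>a = 2\<close> the members are the pairs through one
  point and the bound is attained.\<close>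

lemma pair_size_star:
  assumes X: "finite X" "K \<union> L = X" "K \<inter> L = {}" and n: "2 * a < card X" "2 \<le> a"
    and L: "card L = a - 1" and S: "\<S> = (\<lambda>z. insert z L) ` K"
  shows "pair_size X a \<S> + ((card X - a) choose a) \<le> (card X choose a) + 1"
    and "3 \<le> a \<Longrightarrow> pair_size X a \<S> + ((card X - a) choose a) < (card X choose a) + 1"
proof -
  have fin: "finite K" "finite L" using X finite_Un by auto
  have "card X = card K + card L" using X fin card_Un_disjoint by metis
  then have cK: "card K = Suc (card X - a)" using n L by auto
  have "hitting X a \<S> \<inter> nsets K a = {}"
  proof (rule ccontr)
    assume "hitting X a \<S> \<inter> nsets K a \<noteq> {}"
    then obtain A where A: "A \<in> hitting X a \<S>" "A \<subseteq> K" "card A = a" unfolding nsets_def by auto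
    then have "A \<noteq> K" using cK n by auto
    then obtain z where z: "z \<in> K" "z \<notin> A" using A by auto
    then have "A \<inter> insert z L = {}" using A X by auto
    then show False using A z S unfolding hitting_def by auto
  qed
  then have 1: "card (hitting X a \<S>) + (card K choose a) \<le> card X choose a"
    using card_hitting_avoid[of X "nsets K a" a \<S>] X fin nsets_mono[of K X a] card_nsets[OF fin(1)]
    by auto
  have 2: "card \<S> \<le> Suc (card X - a)" unfolding S using card_image_le[OF fin(1)] cK by metis
  obtain a' where a': "a = Suc a'" using n by (cases a) auto
  have 3: "card K choose a = ((card X - a) choose (a - 1)) + ((card X - a) choose a)"
    unfolding cK a' by simp
  have 4: "card X - a \<le> (card X - a) choose (a - 1)" using n by (intro binomial_ge_top) auto
  show "pair_size X a \<S> + ((card X - a) choose a) \<le> (card X choose a) + 1"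
    using 1 2 3 4 unfolding pair_size_def by linarith
  assume "3 \<le> a"
  then have "card X - a < (card X - a) choose (a - 1)" using n by (intro binomial_gr_top) auto
  then show "pair_size X a \<S> + ((card X - a) choose a) < (card X choose a) + 1"
    using 1 2 3 unfolding pair_size_def by linarith
qed

text \<open>A set meeting \<open>K\<close> in at most one point misses one of the
  \<open>a\<close>-subsets of \<open>K\<close>. Such sets of size \<open>a\<close> form
  \<open>?D\<close>, whose size exceeds \<open>(card X - a) choose a\<close> by
  \<open>a * (card L choose (a - 1))\<close>, while \<open>\<S>\<close> has at most
  \<open>a + 2\<close> members.\<close>

lemma pair_size_clique:
  assumes X: "finite X" "K \<union> L = X" "K \<inter> L = {}" and n: "2 * a < card X" "2 \<le> a"
    and K: "card K = Suc a"
    and sub: "(\<lambda>z. K - {z}) ` K \<subseteq> \<S>" and sup: "\<S> \<subseteq> insert L ((\<lambda>z. K - {z}) ` K)"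
  shows "pair_size X a \<S> + ((card X - a) choose a) < (card X choose a) + 1"
proof -
  have fin: "finite K" "finite L" using X finite_Un by auto
  have "card X = card K + card L" using X fin card_Un_disjoint by metis
  then have cL: "card X - a = Suc (card L)" using K n by auto
  let ?E = "(\<lambda>(z, A). insert z A) ` (K \<times> nsets L (a - 1))"
  let ?D = "nsets L a \<union> ?E"
  obtain a' where a': "a = Suc a'" using n by (cases a) auto
  have inj: "inj_on (\<lambda>(z, A). insert z A) (K \<times> nsets L (a - 1))"
  proof (rule inj_onI)
    fix p q assume pq: "p \<in> K \<times> nsets L (a - 1)" "q \<in> K \<times> nsets L (a - 1)"
      and eq: "(\<lambda>(z, A). insert z A) p = (\<lambda>(z, A). insert z A) q"
    obtain z A w C where d: "p = (z, A)" "q = (w, C)" by (cases p; cases q)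
    have AC: "A \<inter> K = {}" "C \<inter> K = {}" "z \<in> K" "w \<in> K"
      using pq d X(3) unfolding nsets_def by auto
    have "insert z A = insert w C" using eq d by simp
    moreover have "z = w" using AC calculation by auto
    moreover have "A = insert z A - K" "C = insert w C - K" using AC by auto
    ultimately have "z = w" "A = C" by auto
    then show "p = q" using d by simp
  qed
  have "card ?E = card K * (card L choose (a - 1))"
    using inj fin by (simp add: card_image card_cartesian_product card_nsets)
  moreover have "nsets L a \<inter> ?E = {}" using X(3) unfolding nsets_def by auto
  moreover have "finite ?E" using fin by (simp add: finite_imp_finite_nsets)
  ultimately have cD: "card ?D = (card L choose a) + Suc a * (card L choose (a - 1))"
    using fin K by (simp add: card_Un_disjoint finite_imp_finite_nsets card_nsets)
  have DX: "?D \<subseteq> nsets X a"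
  proof -
    have "nsets L a \<subseteq> nsets X a" using X(2) by (intro nsets_mono) auto
    moreover have "insert z A \<in> nsets X a" if "z \<in> K" "A \<in> nsets L (a - 1)" for z A
    proof -
      have "z \<notin> A" using that X(3) unfolding nsets_def by auto
      then show ?thesis using that X(2) a' unfolding nsets_def by auto
    qed
    ultimately show ?thesis by auto
  qed
  have "hitting X a \<S> \<inter> ?D = {}"
  proof (rule ccontr)
    assume "hitting X a \<S> \<inter> ?D \<noteq> {}"
    then obtain A where A: "A \<in> hitting X a \<S>" "A \<in> ?D" by auto
    have "K \<noteq> {}" using K by auto
    have "\<exists>z\<in>K. A \<inter> (K - {z}) = {}"
    proof (cases "A \<in> nsets L a")
      case True
      then have "A \<inter> K = {}" using X(3) unfolding nsets_def by auto
      then show ?thesis using \<open>K \<noteq> {}\<close> by blast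
    next
      case False
      then obtain z C where "z \<in> K" "C \<in> nsets L (a - 1)" "A = insert z C" using A by auto
      then show ?thesis using X(3) unfolding nsets_def by auto
    qed
    then obtain z where z: "z \<in> K" "A \<inter> (K - {z}) = {}" by blast
    then have "K - {z} \<in> \<S>" using sub by auto
    then show False using A(1) z(2) unfolding hitting_def by auto
  qed
  then have 1: "card (hitting X a \<S>) + card ?D \<le> card X choose a"
    using card_hitting_avoid[OF X(1) DX] by auto
  have 2: "card \<S> \<le> a + 2"
  proof -
    have "card \<S> \<le> card (insert L ((\<lambda>z. K - {z}) ` K))" using sup fin by (intro card_mono) auto
    also have "\<dots> \<le> Suc (card ((\<lambda>z. K - {z}) ` K))" using fin by (simp add: card_insert_if)
    also have "\<dots> \<le> Suc (card K)" using card_image_le[OF fin(1)] by simp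
    finally show ?thesis using K by simp
  qed
  have 3: "(card X - a) choose a = (card L choose (a - 1)) + (card L choose a)"
    using cL a' by simp
  have "card L \<le> card L choose (a - 1)" using n cL by (intro binomial_ge_top) auto
  then have "a \<le> card L choose (a - 1)" using n cL by auto
  then have "a * a \<le> a * (card L choose (a - 1))" by simp
  moreover have "2 * a \<le> a * a" using n by simp
  ultimately have 4: "a + 2 \<le> a * (card L choose (a - 1))" using n by linarith
  show ?thesis using 1 2 3 4 cD unfolding pair_size_def by simp
qed

text \<open>By \<open>uniq\<close> at most one member fails to separate a given point of
  \<open>K\<close> from a given point of \<open>L\<close>. Exchanges tend to produce a second one,
  so a member cutting \<open>K\<close> must contain \<open>L\<close> or miss it; these cases lead to
  the star and to the clique.\<close>

lemma pair_size_two_classes: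
  assumes X: "finite X" "K \<union> L = X" "K \<inter> L = {}" "L \<noteq> {}" and n: "2 * a < card X" "2 \<le> a"
    and S: "\<S> \<subseteq> nsets X a"
    and clK: "\<And>x y B. \<lbrakk>x \<in> K; y \<in> K; B \<in> \<S>; x \<in> B; y \<notin> B\<rbrakk> \<Longrightarrow> insert y (B - {x}) \<in> \<S>"
    and clL: "\<And>x y B. \<lbrakk>x \<in> L; y \<in> L; B \<in> \<S>; x \<in> B; y \<notin> B\<rbrakk> \<Longrightarrow> insert y (B - {x}) \<in> \<S>"
    and uniq: "\<And>x y B C. \<lbrakk>x \<in> K; y \<in> L; B \<in> \<S>; C \<in> \<S>; x \<in> B \<longleftrightarrow> y \<in> B; x \<in> C \<longleftrightarrow> y \<in> C\<rbrakk> \<Longrightarrow> B = C"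
    and B: "B \<in> \<S>" "B \<inter> K \<noteq> {}" "\<not> K \<subseteq> B"
  shows "pair_size X a \<S> + ((card X - a) choose a) \<le> (card X choose a) + 1
     \<and> (3 \<le> a \<longrightarrow> pair_size X a \<S> + ((card X - a) choose a) < (card X choose a) + 1)"
proof -
  have fin: "finite K" "finite L" using X finite_Un by auto
  have cX: "card X = card K + card L" using X fin card_Un_disjoint by metis
  have mem: "C \<subseteq> K \<union> L" "finite C" "card C = a" if "C \<in> \<S>" for C
    using S X that unfolding nsets_def by auto
  obtain x x' where x: "x \<in> B" "x \<in> K" and x': "x' \<in> K" "x' \<notin> B" using B by auto
  consider (mixed) "B \<inter> L \<noteq> {}" "\<not> L \<subseteq> B" | (full) "L \<subseteq> B" | (empty) "B \<inter> L = {}" by blast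
  then show ?thesis
  proof cases
    case mixed
    then obtain y y' where y: "y \<in> B" "y \<in> L" and y': "y' \<in> L" "y' \<notin> B" by auto
    \<comment> \<open>One exchange in each class turns \<open>B\<close>, which contains
      \<open>x\<close> and \<open>y\<close>, into a member containing neither, against
      \<open>uniq\<close>.\<close>
    have 1: "insert x' (B - {x}) \<in> \<S>" using clK x x' B by auto
    have "y \<noteq> x" "y' \<noteq> x'" "y' \<noteq> x" "x \<noteq> x'" "y \<noteq> y'" "y \<noteq> x'" using x x' y y' X(3) by auto
    then have "insert y' (insert x' (B - {x}) - {y}) \<in> \<S>"
      using clL[OF y(2) y'(1) 1] y y' by auto
    then have "B = insert y' (insert x' (B - {x}) - {y})"
      using x y \<open>x \<noteq> x'\<close> \<open>y' \<noteq> x\<close> \<open>y \<noteq> y'\<close> B(1) by (intro uniq[of x y]) auto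
    then show ?thesis using y' by auto
  next
    case full
    obtain y where y: "y \<in> L" using X by auto
    \<comment> \<open>Exchanging a second point \<open>z\<close> of \<open>B \<inter> K\<close> for
      \<open>x'\<close> would give another member through both \<open>x\<close> and
      \<open>y\<close>.\<close>
    have BK: "B \<inter> K = {x}"
    proof (rule ccontr)
      assume "B \<inter> K \<noteq> {x}"
      then obtain z where z: "z \<in> B" "z \<in> K" "z \<noteq> x" using x by auto
      have "insert x' (B - {z}) \<in> \<S>" using clK z x' B by auto
      moreover have "y \<noteq> z" "y \<noteq> x'" using y z x' X(3) by auto
      ultimately have "B = insert x' (B - {z})"
        using x y z full B by (intro uniq[of x y]) auto
      then show False using x' by auto
    qed
    then have Beq: "B = insert x L" using full mem[OF B(1)] by auto
    have cL: "card L = a - 1" using mem[OF B(1)] Beq x X(3) fin by (auto simp: card_insert_if)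
    have star: "insert z L \<in> \<S>" if "z \<in> K" for z
    proof (cases "z = x")
      case False
      then have "z \<notin> B" using that BK by auto
      then have "insert z (B - {x}) \<in> \<S>" using clK x that B by auto
      moreover have "B - {x} = L" using Beq x X(3) by auto
      ultimately show ?thesis by simp
    qed (use Beq B in simp)
    have sup: "C \<in> (\<lambda>z. insert z L) ` K" if C: "C \<in> \<S>" for C
    proof -
      have LC: "L \<subseteq> C"
      proof (rule ccontr)
        assume "\<not> L \<subseteq> C"
        then obtain w where w: "w \<in> L" "w \<notin> C" by auto
        have "z \<in> C" if "z \<in> K" for z
        proof (rule ccontr)
          assume "z \<notin> C"
          then have "C = insert z L" using w that star C by (intro uniq[of z w]) auto
          then show False using w by simp
        qed
        then have "card K \<le> card C" using mem[OF C] by (intro card_mono) auto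
        then show False using mem[OF C] cX cL n by auto
      qed
      have "card (C - L) = 1" using LC mem[OF C] cL n fin by (simp add: card_Diff_subset)
      then obtain z where "C - L = {z}" by (auto simp: card_1_singleton_iff)
      then show ?thesis using LC mem[OF C] by (intro image_eqI[of _ _ z]) auto
    qed
    have "\<S> = (\<lambda>z. insert z L) ` K" using sup star by auto
    then show ?thesis using pair_size_star[OF X(1-3) n cL] by simp
  next
    case empty
    obtain y where y: "y \<in> L" using X by auto
    \<comment> \<open>Exchanging \<open>x\<close> for a second missing point of \<open>K\<close>
      would give another member avoiding both \<open>x'\<close> and \<open>y\<close>.\<close>
    have BK: "K - B = {x'}"
    proof (rule ccontr)
      assume "K - B \<noteq> {x'}"
      then obtain z where z: "z \<notin> B" "z \<in> K" "z \<noteq> x'" using x' by auto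
      have "insert z (B - {x}) \<in> \<S>" using clK z x B by auto
      moreover have "y \<noteq> z" "y \<notin> B" using y z X(3) empty by auto
      ultimately have "B = insert z (B - {x})"
        using x' y z B by (intro uniq[of x' y]) auto
      then show False using z by auto
    qed
    have Beq: "B = K - {x'}" using empty mem[OF B(1)] BK by auto
    then have cK: "card K = Suc a" using mem[OF B(1)] card_Suc_Diff1[OF fin(1) x'(1)] by simp
    have sub: "K - {z} \<in> \<S>" if "z \<in> K" for z
    proof (cases "z = x'")
      case False
      then have "z \<in> B" using that Beq by auto
      then have "insert x' (B - {z}) \<in> \<S>" using clK x' that B by auto
      moreover have "insert x' (B - {z}) = K - {z}" using Beq x' False by auto
      ultimately show ?thesis by simp
    qed (use Beq B in simp)
    have sup: "C \<in> insert L ((\<lambda>z. K - {z}) ` K)" if C: "C \<in> \<S>" for C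
    proof (cases "C \<inter> L = {}")
      case True
      then have "C \<subseteq> K" using mem[OF C] by auto
      moreover have "card (K - C) = 1"
        using \<open>C \<subseteq> K\<close> mem[OF C] cK by (simp add: card_Diff_subset)
      then obtain z where "K - C = {z}" by (auto simp: card_1_singleton_iff)
      ultimately show ?thesis by (intro insertI2 image_eqI[of _ _ z]) auto
    next
      case False
      then obtain w where w: "w \<in> C" "w \<in> L" by auto
      have out: "z \<notin> C" if "z \<in> K" for z
      proof
        assume "z \<in> C"
        then have "C = K - {z}" using w that sub[OF that] C X(3) by (intro uniq[of z w]) auto
        then show False using \<open>z \<in> C\<close> by simp
      qed
      have "L \<subseteq> C"
      proof
        fix v assume v: "v \<in> L"
        show "v \<in> C"
        proof (rule ccontr)
          assume "v \<notin> C"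
          then have "C = K - {x}" using v x(2) out[OF x(2)] sub[OF x(2)] C X(3)
            by (intro uniq[of x v]) auto
          then show False using w X(3) by auto
        qed
      qed
      then have "C = L" using mem[OF C] out by auto
      then show ?thesis by simp
    qed
    have "(\<lambda>z. K - {z}) ` K \<subseteq> \<S>" "\<S> \<subseteq> insert L ((\<lambda>z. K - {z}) ` K)" using sub sup by auto
    then show ?thesis using pair_size_clique[OF X(1-3) n cK, of \<S>] by simp
  qed
qed

text \<open>A counterexample has at least four members. Points whose transposition fixes
  \<open>\<S>\<close> are equivalent. Given three pairwise inequivalent points, every member fails
  to separate two of them, so there would be at most three members. Hence there are exactly two
  classes.\<close>

lemma pair_size_transposition_bound:
  assumes X: "finite X" and n: "2 * a < card X" "2 \<le> a"
    and S: "\<S> \<subseteq> nsets X a" "hitting X a \<S> \<noteq> {}" "2 \<le> card \<S>"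
    and swap: "\<And>x y. \<lbrakk>x \<in> X; y \<in> X\<rbrakk> \<Longrightarrow>
      card (\<S> \<inter> (`) (transpose x y) ` \<S>) \<le> 1 \<or> (`) (transpose x y) ` \<S> = \<S>"
  shows "pair_size X a \<S> + ((card X - a) choose a) \<le> (card X choose a) + 1
     \<and> (3 \<le> a \<longrightarrow> pair_size X a \<S> + ((card X - a) choose a) < (card X choose a) + 1)"
proof (rule ccontr)
  assume neg: "\<not> ?thesis"
  have fS: "finite \<S>" using S(1) X finite_imp_finite_nsets finite_subset by blast
  have mem: "C \<subseteq> X" "finite C" "card C = a" if "C \<in> \<S>" for C
    using S(1) that unfolding nsets_def by auto
  have four: "4 \<le> card \<S>"
  proof -
    obtain B C where BC: "B \<in> \<S>" "C \<in> \<S>" "B \<noteq> C"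
      using S(3) by (metis One_nat_def Suc_1 card_le_Suc0_iff_eq fS not_less_eq_eq)
    have "\<not> B \<subseteq> C" using BC mem by (metis card_subset_eq)
    then obtain p where p: "p \<in> B" "p \<notin> C" by auto
    \<comment> \<open>Two kinds of sets do not hit \<open>\<S>\<close>: those missing
      \<open>B\<close>, and those through \<open>p\<close> missing \<open>C\<close>. They are
      different because \<open>p\<close> lies in \<open>B\<close>. A violation of the bound must
      make up for the second kind by a large \<open>card \<S>\<close>.\<close>
    let ?D = "{A \<in> nsets X a. A \<inter> B = {}}"
    let ?E = "insert p ` nsets (X - C - {p}) (a - 1)"
    have pX: "p \<in> X" using p BC mem by auto
    have inj: "inj_on (insert p) (nsets (X - C - {p}) (a - 1))"
      unfolding inj_on_def nsets_def by blast
    have "card (X - C - {p}) = card X - a - 1"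
      using mem[OF BC(2)] pX p by (simp add: card_Diff_subset)
    then have cE: "card ?E = (card X - a - 1) choose (a - 1)"
      using inj X by (simp add: card_image card_nsets)
    have cD: "card ?D = (card X - a) choose a"
      using BC S(1) by (intro card_disjoint_nsets[OF X]) auto
    have fD: "finite ?D" "finite ?E" using X by (auto simp: finite_imp_finite_nsets)
    have "?D \<inter> ?E = {}" using p by auto
    then have cDE: "card (?D \<union> ?E) = ((card X - a) choose a) + ((card X - a - 1) choose (a - 1))"
      using cD cE fD by (simp add: card_Un_disjoint)
    have EX: "insert p A \<in> nsets X a" if "A \<in> nsets (X - C - {p}) (a - 1)" for A
    proof -
      have "p \<notin> A" "A \<subseteq> X" "finite A" "card A = a - 1" using that unfolding nsets_def by auto
      then show ?thesis using pX n unfolding nsets_def by auto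
    qed
    have "hitting X a \<S> \<inter> ?D = {}" using BC unfolding hitting_def by auto
    moreover have "hitting X a \<S> \<inter> ?E = {}"
    proof -
      have "insert p A \<inter> C = {}" if "A \<in> nsets (X - C - {p}) (a - 1)" for A
        using that p unfolding nsets_def by auto
      then show ?thesis using BC unfolding hitting_def by blast
    qed
    ultimately have "card (hitting X a \<S>) + card (?D \<union> ?E) \<le> card X choose a"
      using EX by (intro card_hitting_avoid[OF X]) auto
    moreover have "card X - a - 1 \<le> (card X - a - 1) choose (a - 1)"
      using n by (intro binomial_ge_top) auto
    moreover have "a \<le> card X - a - 1" using n by simp
    ultimately show ?thesis using neg cDE n unfolding pair_size_def by auto
  qed
  define eqv where "eqv x y \<longleftrightarrow> (`) (transpose x y) ` \<S> = \<S>" for x y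
  have eqv_exch: "insert y (B - {x}) \<in> \<S>" if "eqv x y" "B \<in> \<S>" "x \<in> B" "y \<notin> B" for x y B
  proof -
    have "transpose x y ` B = insert y (B - {x})"
    proof (intro equalityI subsetI)
      fix z assume "z \<in> transpose x y ` B"
      then show "z \<in> insert y (B - {x})"
        using that(3,4) by (auto simp: Transposition.transpose_def split: if_splits)
    next
      fix z assume "z \<in> insert y (B - {x})"
      then show "z \<in> transpose x y ` B"
        using that(3,4) by (auto simp: in_transpose_image_iff Transposition.transpose_def)
    qed
    then show ?thesis using that unfolding eqv_def by (metis imageI)
  qed
  have eqv_refl: "eqv x x" for x unfolding eqv_def by simp
  have eqv_sym: "eqv x y \<Longrightarrow> eqv y x" for x y unfolding eqv_def by (simp add: transpose_commute)
  have eqv_trans: "eqv x z" if "eqv x y" "eqv y z" for x y z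
  proof (cases "x = y \<or> y = z \<or> x = z")
    case True
    then show ?thesis using that eqv_refl by auto
  next
    case False
    then have "transpose x z = transpose x y \<circ> transpose y z \<circ> transpose x y"
      by (intro ext) (auto simp: Transposition.transpose_def)
    then have "(`) (transpose x z) ` \<S> = (`) (transpose x y) ` (`) (transpose y z) ` (`) (transpose x y) ` \<S>"
      by (simp add: image_comp comp_def image_image)
    then show ?thesis using that unfolding eqv_def by simp
  qed
  \<comment> \<open>A set containing both or neither of \<open>x\<close> and \<open>y\<close> is
    fixed by their transposition.\<close>
  have nonsep: "card {B \<in> \<S>. x \<in> B \<longleftrightarrow> y \<in> B} \<le> 1" if "x \<in> X" "y \<in> X" "\<not> eqv x y" for x y
  proof -
    have "{B \<in> \<S>. x \<in> B \<longleftrightarrow> y \<in> B} \<subseteq> \<S> \<inter> (`) (transpose x y) ` \<S>"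
    proof
      fix B assume B: "B \<in> {B \<in> \<S>. x \<in> B \<longleftrightarrow> y \<in> B}"
      then have "transpose x y ` B = B" by simp
      then show "B \<in> \<S> \<inter> (`) (transpose x y) ` \<S>" using B by (metis (mono_tags, lifting) IntI imageI mem_Collect_eq)
    qed
    then have "card {B \<in> \<S>. x \<in> B \<longleftrightarrow> y \<in> B} \<le> card (\<S> \<inter> (`) (transpose x y) ` \<S>)"
      using fS by (intro card_mono) auto
    then show ?thesis using swap[OF that(1,2)] that(3) unfolding eqv_def by auto
  qed
  \<comment> \<open>If all points were equivalent, exchanges would produce every
    \<open>a\<close>-set, including one disjoint from a given hitting set, as
    \<open>2 * a < card X\<close>.\<close>
  have "\<exists>x\<in>X. \<exists>y\<in>X. \<not> eqv x y"
  proof (rule ccontr)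
    assume "\<not> ?thesis"
    then have all: "eqv x y" if "x \<in> X" "y \<in> X" for x y using that by blast
    obtain B where B: "B \<in> \<S>" using S(3) by fastforce
    have in_S: "C \<in> \<S>" if "C \<in> nsets X a" for C
    proof (rule exchange_closed[of X \<S> B])
      show "card (C \<inter> X) = card (B \<inter> X)" "C - X = B - X"
        using that mem[OF B] unfolding nsets_def by (auto simp: Int_absorb2)
    qed (use that mem[OF B] B all eqv_exch in \<open>auto simp: nsets_def\<close>)
    obtain A where A: "A \<in> hitting X a \<S>" using S(2) by auto
    then have AX: "A \<subseteq> X" "finite A" "card A = a" unfolding hitting_def nsets_def by auto
    then have "a \<le> card (X - A)" using n by (simp add: card_Diff_subset)
    then obtain C where "C \<subseteq> X - A" "card C = a" "finite C" by (rule obtain_subset_with_card_n)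
    then have "C \<in> \<S>" "A \<inter> C = {}" using in_S unfolding nsets_def by auto
    then show False using A unfolding hitting_def by auto
  qed
  then obtain x0 y0 where xy: "x0 \<in> X" "y0 \<in> X" "\<not> eqv x0 y0" by blast
  have dich: "eqv z x0 \<or> eqv z y0" if z: "z \<in> X" for z
  proof (rule ccontr)
    assume "\<not> ?thesis"
    then have "card {B \<in> \<S>. z \<in> B \<longleftrightarrow> x0 \<in> B} \<le> 1" "card {B \<in> \<S>. z \<in> B \<longleftrightarrow> y0 \<in> B} \<le> 1"
      "card {B \<in> \<S>. x0 \<in> B \<longleftrightarrow> y0 \<in> B} \<le> 1" using nonsep z xy by auto
    moreover have "\<S> = {B \<in> \<S>. z \<in> B \<longleftrightarrow> x0 \<in> B} \<union> {B \<in> \<S>. z \<in> B \<longleftrightarrow> y0 \<in> B}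
        \<union> {B \<in> \<S>. x0 \<in> B \<longleftrightarrow> y0 \<in> B}" by auto
    then have "card \<S> \<le> card {B \<in> \<S>. z \<in> B \<longleftrightarrow> x0 \<in> B} + card {B \<in> \<S>. z \<in> B \<longleftrightarrow> y0 \<in> B}
        + card {B \<in> \<S>. x0 \<in> B \<longleftrightarrow> y0 \<in> B}"
      by (metis (no_types, lifting) add_le_mono1 card_Un_le le_trans)
    ultimately show False using four by simp
  qed
  let ?K = "{z \<in> X. eqv z x0}" and ?L = "{z \<in> X. \<not> eqv z x0}"
  have KL: "?K \<union> ?L = X" "?K \<inter> ?L = {}" "?K \<noteq> {}" "?L \<noteq> {}"
    using xy eqv_refl eqv_sym by blast+
  have clK: "insert y (B - {x}) \<in> \<S>" if "x \<in> ?K" "y \<in> ?K" "B \<in> \<S>" "x \<in> B" "y \<notin> B" for x y B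
    using that eqv_exch eqv_trans eqv_sym by blast
  have clL: "insert y (B - {x}) \<in> \<S>" if "x \<in> ?L" "y \<in> ?L" "B \<in> \<S>" "x \<in> B" "y \<notin> B" for x y B
    using that eqv_exch eqv_trans eqv_sym dich by blast
  have uniq: "B = C" if "x \<in> ?K" "y \<in> ?L" "B \<in> \<S>" "C \<in> \<S>" "x \<in> B \<longleftrightarrow> y \<in> B" "x \<in> C \<longleftrightarrow> y \<in> C"
    for x y B C
  proof -
    have "\<not> eqv x y" using that eqv_sym eqv_trans by blast
    then have "card {B \<in> \<S>. x \<in> B \<longleftrightarrow> y \<in> B} \<le> Suc 0" using nonsep that by auto
    then show ?thesis using that fS by (simp add: card_le_Suc0_iff_eq)
  qed
  \<comment> \<open>Among the nonempty proper subsets of \<open>X\<close>, only \<open>?K\<close>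
    and \<open>?L\<close> cut neither class.\<close>
  have "\<not> \<S> \<subseteq> {?K, ?L}"
  proof
    assume "\<S> \<subseteq> {?K, ?L}"
    then have "card \<S> \<le> card {?K, ?L}" by (intro card_mono) auto
    also have "\<dots> \<le> 2" by (simp add: card_insert_if)
    finally show False using four by simp
  qed
  then obtain B where B: "B \<in> \<S>" "B \<noteq> ?K" "B \<noteq> ?L" by auto
  have "B \<noteq> {}" using mem[OF B(1)] n by auto
  have "B \<noteq> X" using mem[OF B(1)] n by auto
  show False
  proof (cases "B \<inter> ?K \<noteq> {} \<and> \<not> ?K \<subseteq> B")
    case True
    then have K: "B \<inter> ?K \<noteq> {}" "\<not> ?K \<subseteq> B" by auto
    show ?thesis
      by (rule notE[OF neg], rule pair_size_two_classes[OF X KL(1,2,4) n S(1) _ _ _ B(1) K])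
        (erule (4) clK, erule (4) clL, erule (5) uniq)
  next
    case False
    have BX: "B \<subseteq> X" using mem[OF B(1)] by simp
    have L: "B \<inter> ?L \<noteq> {}" "\<not> ?L \<subseteq> B"
      using False BX B(2,3) \<open>B \<noteq> {}\<close> \<open>B \<noteq> X\<close> KL(1) by blast+
    have KL': "?L \<union> ?K = X" "?L \<inter> ?K = {}" using KL by auto
    have uniq': "B = C" if "x \<in> ?L" "y \<in> ?K" "B \<in> \<S>" "C \<in> \<S>" "x \<in> B \<longleftrightarrow> y \<in> B" "x \<in> C \<longleftrightarrow> y \<in> C"
      for x y B C using uniq[of y x B C] that by blast
    show ?thesis
      by (rule notE[OF neg], rule pair_size_two_classes[OF X KL' KL(3) n S(1) _ _ _ B(1) L])
        (erule (4) clL, erule (4) clK, erule (5) uniq')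
  qed
qed

lemma pair_size_singleton:
  assumes "finite X" "B \<in> nsets X a"
  shows "pair_size X a {B} + ((card X - a) choose a) = (card X choose a) + 1"
  using hitting_singleton_card[OF assms, of a] unfolding pair_size_def by simp

lemma subset_hitting_hitting:
  "\<S> \<subseteq> nsets X b \<Longrightarrow> \<S> \<subseteq> hitting X b (hitting X a \<S>)"
  unfolding hitting_def by auto

text \<open>The function \<^const>\<open>pair_size\<close> is supermodular and invariant under permutations of \<open>X\<close>. Hence
  a smallest maximizer with at least two sets on each side meets its image under a transposition
  in at most one set, unless the two coincide; otherwise the intersection would be a smaller one.\<close>

theorem pair_size_le:
  assumes X: "finite X" and n: "2 * a < card X" "2 \<le> a"
    and S: "\<S> \<subseteq> nsets X a" "\<S> \<noteq> {}" "hitting X a \<S> \<noteq> {}"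
  shows "pair_size X a \<S> + ((card X - a) choose a) \<le> (card X choose a) + 1"
    and "\<lbrakk>3 \<le> a; pair_size X a \<S> + ((card X - a) choose a) = (card X choose a) + 1\<rbrakk>
      \<Longrightarrow> card \<S> = 1 \<or> card (hitting X a \<S>) = 1"
proof -
  let ?M = "(card X choose a) + 1"
  let ?f = "\<lambda>\<S>. pair_size X a \<S> + ((card X - a) choose a)"
  define adm where "adm \<T> \<longleftrightarrow> \<T> \<subseteq> nsets X a \<and> \<T> \<noteq> {} \<and> hitting X a \<T> \<noteq> {}" for \<T>
  define big where "big \<T> \<longleftrightarrow> \<T> \<subseteq> nsets X a \<and> 2 \<le> card \<T> \<and> 2 \<le> card (hitting X a \<T>)" for \<T>
  have fin: "finite \<T>" if "\<T> \<subseteq> nsets X a" for \<T>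
    using that X finite_imp_finite_nsets finite_subset by blast
  have big_adm: "adm \<T>" if "big \<T>" for \<T>
    using that unfolding big_def adm_def by auto
  \<comment> \<open>If \<open>hitting X a \<T>\<close> is a singleton, \<open>\<T>\<close> lies in
    the family of sets hitting its only member, so both cases reduce to
    \<open>pair_size_singleton\<close>.\<close>
  have small: "?f \<T> \<le> ?M" if adm: "adm \<T>" and nb: "\<not> big \<T>" for \<T>
  proof -
    have T: "\<T> \<subseteq> nsets X a" "0 < card \<T>" "0 < card (hitting X a \<T>)"
      using adm fin finite_hitting[OF X] unfolding adm_def by (auto simp: card_gt_0_iff)
    then consider "card \<T> = 1" | "card (hitting X a \<T>) = 1" using nb unfolding big_def by linarith
    then show ?thesis
    proof cases
      case 1
      then obtain B where B: "\<T> = {B}" by (auto simp: card_1_singleton_iff)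
      then have "B \<in> nsets X a" using T by auto
      then show ?thesis using pair_size_singleton[OF X] B by simp
    next
      case 2
      then obtain C where C: "hitting X a \<T> = {C}" by (auto simp: card_1_singleton_iff)
      then have CX: "C \<in> nsets X a" using hitting_subset[of X a \<T>] by auto
      have "\<T> \<subseteq> hitting X a {C}" using subset_hitting_hitting[OF T(1), of a] C by simp
      then have "card \<T> \<le> card (hitting X a {C})" using X by (intro card_mono finite_hitting)
      then show ?thesis using pair_size_singleton[OF X CX] 2 unfolding pair_size_def by simp
    qed
  qed
  have large: "?f \<T> \<le> ?M \<and> (3 \<le> a \<longrightarrow> ?f \<T> < ?M)" if bT: "big \<T>" for \<T>
  proof (rule ccontr)
    assume neg: "\<not> ?thesis"
    have "\<forall>\<U>. big \<U> \<longrightarrow> ?f \<U> < 2 * (card X choose a) + ((card X - a) choose a) + 1"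
    proof (intro allI impI)
      fix \<U> assume "big \<U>"
      then have "card \<U> \<le> card X choose a" "card (hitting X a \<U>) \<le> card X choose a"
        using card_mono[OF finite_imp_finite_nsets[OF X], of _ a] hitting_subset[of X a \<U>]
        unfolding big_def card_nsets[OF X] by auto
      then show "?f \<U> < 2 * (card X choose a) + ((card X - a) choose a) + 1"
        unfolding pair_size_def by simp
    qed
    then obtain \<U> where U: "big \<U>" "\<And>\<V>. big \<V> \<Longrightarrow> ?f \<V> \<le> ?f \<U>"
      using ex_has_greatest_nat[of big \<T> ?f] bT by blast
    then obtain \<V> where V: "big \<V>" "?f \<V> = ?f \<U>"
      and least: "\<And>\<W>. \<lbrakk>big \<W>; ?f \<W> = ?f \<U>\<rbrakk> \<Longrightarrow> card \<V> \<le> card \<W>"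
      using ex_has_least_nat[of "\<lambda>\<V>. big \<V> \<and> ?f \<V> = ?f \<U>" \<U> card] by blast
    have negV: "\<not> (?f \<V> \<le> ?M \<and> (3 \<le> a \<longrightarrow> ?f \<V> < ?M))"
      using neg U(2)[OF bT] V(2) by auto
    have geM: "?M \<le> ?f \<V>" using negV by auto
    have max: "?f \<W> \<le> ?f \<V>" if "adm \<W>" for \<W>
      using small[OF that] geM U(2) V(2) by (cases "big \<W>") auto
    have VX: "\<V> \<subseteq> nsets X a" "2 \<le> card \<V>" "2 \<le> card (hitting X a \<V>)" using V unfolding big_def by auto
    \<comment> \<open>The two sides can be interchanged: \<open>hitting X a \<V>\<close> is a
      maximizer too, so minimality makes \<open>\<V>\<close> the smaller side.\<close>
    have le: "card \<V> \<le> card (hitting X a \<V>)"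
    proof -
      have sub: "\<V> \<subseteq> hitting X a (hitting X a \<V>)" by (rule subset_hitting_hitting[OF VX(1)])
      then have c: "card \<V> \<le> card (hitting X a (hitting X a \<V>))" using X by (intro card_mono finite_hitting)
      then have "big (hitting X a \<V>)" using VX hitting_subset[of X a \<V>] unfolding big_def by linarith
      moreover have "?f \<V> \<le> ?f (hitting X a \<V>)" using c unfolding pair_size_def by simp
      ultimately show ?thesis using least U(2) V(2) by (metis le_antisym)
    qed
    have "card (\<V> \<inter> (`) (transpose x y) ` \<V>) \<le> 1 \<or> (`) (transpose x y) ` \<V> = \<V>"
      if xy: "x \<in> X" "y \<in> X" for x y
    proof (rule disjCI)
      let ?\<pi> = "transpose x y"
      let ?W = "(`) ?\<pi> ` \<V>"
      have \<pi>: "?\<pi> permutes X" using xy by (rule permutes_swap_id)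
      assume ne: "?W \<noteq> \<V>"
      show "card (\<V> \<inter> ?W) \<le> 1"
      proof (rule ccontr)
        assume "\<not> card (\<V> \<inter> ?W) \<le> 1"
        then have two: "2 \<le> card (\<V> \<inter> ?W)" by simp
        have sub: "hitting X a \<V> \<subseteq> hitting X a (\<V> \<inter> ?W)" by (intro hitting_antimono) auto
        then have "card (hitting X a \<V>) \<le> card (hitting X a (\<V> \<inter> ?W))"
          using X by (intro card_mono finite_hitting)
        then have bI: "big (\<V> \<inter> ?W)" using two VX unfolding big_def by auto
        have hW: "hitting X a ?W = (`) ?\<pi> ` hitting X a \<V>" by (rule hitting_image_permutes[OF \<pi>])
        have cW: "card ?W = card \<V>" "card (hitting X a ?W) = card (hitting X a \<V>)"
          unfolding hW by (rule card_image_permutes[OF \<pi>])+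
        have WX: "?W \<subseteq> nsets X a" using VX(1) nsets_image_permutes[OF \<pi>] by auto
        have "?f \<V> \<le> ?f (\<V> \<inter> ?W)"
        \<comment> \<open>Supermodularity helps only if the union is admissible. If no set hits both
          families, at least twice as many sets hit \<open>\<V> \<inter> ?W\<close> as hit
          \<open>\<V>\<close>, and \<open>le\<close> concludes.\<close>
        proof (cases "hitting X a \<V> \<inter> hitting X a ?W = {}")
          case True
          have "hitting X a \<V> \<union> hitting X a ?W \<subseteq> hitting X a (\<V> \<inter> ?W)"
            unfolding hitting_def by auto
          then have "card (hitting X a \<V> \<union> hitting X a ?W) \<le> card (hitting X a (\<V> \<inter> ?W))"
            using X by (intro card_mono finite_hitting)
          then have "card (hitting X a \<V>) + card (hitting X a \<V>) \<le> card (hitting X a (\<V> \<inter> ?W))"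
            using True cW by (simp add: card_Un_disjoint finite_hitting[OF X])
          then show ?thesis using le unfolding pair_size_def by linarith
        next
          case False
          then have "adm (\<V> \<union> ?W)"
            using VX WX unfolding adm_def hitting_def by auto
          then have "?f (\<V> \<union> ?W) \<le> ?f \<V>" by (rule max)
          moreover have "pair_size X a \<V> + pair_size X a ?W
              \<le> pair_size X a (\<V> \<inter> ?W) + pair_size X a (\<V> \<union> ?W)"
            using fin[OF VX(1)] fin[OF WX] by (intro pair_size_supermodular[OF X])
          moreover have "pair_size X a ?W = pair_size X a \<V>" using cW unfolding pair_size_def by simp
          ultimately show ?thesis by linarith
        qed
        then have "?f (\<V> \<inter> ?W) = ?f \<U>" using max[OF big_adm[OF bI]] V(2) by simp
        then have "card \<V> \<le> card (\<V> \<inter> ?W)" using least bI by blast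
        then have "\<V> \<inter> ?W = \<V>" using fin[OF VX(1)] by (intro card_subset_eq) (auto simp: card_mono le_antisym)
        then have "\<V> \<subseteq> ?W" by auto
        then show False using ne cW fin[OF WX] by (metis card_subset_eq)
      qed
    qed
    then show False
      using pair_size_transposition_bound[OF X n VX(1) _ VX(2)] V negV big_adm unfolding adm_def by blast
  qed
  have adm: "adm \<S>" using S unfolding adm_def by simp
  show "?f \<S> \<le> ?M" using small[OF adm] large by blast
  assume "3 \<le> a" "?f \<S> = ?M"
  then have "\<not> big \<S>" using large by fastforce
  moreover have "0 < card \<S>" "0 < card (hitting X a \<S>)"
    using S fin finite_hitting[OF X] by (auto simp: card_gt_0_iff)
  ultimately show "card \<S> = 1 \<or> card (hitting X a \<S>) = 1"
    using S(1) unfolding big_def by linarith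
qed

section \<open>Uniform families\<close>

lemma sized_nsets:
  assumes "\<H> \<subseteq> nsets X b"
  shows "sized X b b \<H>" "{S \<in> \<H>. card S = b} = \<H>"
  using assms unfolding sized_def nsets_def by auto

lemma nsets_remove: "\<H> \<subseteq> nsets X b \<Longrightarrow> {S \<in> \<H>. y \<notin> S} \<subseteq> nsets (X - {y}) b"
  unfolding nsets_def by auto

text \<open>Deleting \<open>y\<close> turns the members through \<open>y\<close> into the smallest
  layer, of size \<open>b - 1\<close>, so \<open>hitting_layer_le\<close> bounds that branch;
  \<open>R\<close> is the bound for the other. If two members share \<open>y\<close>, the layer has
  two members and \<open>hitting_layer_less\<close> saves one unit.\<close>

lemma hitting_uniform_split:
  assumes X: "finite X" and H: "\<H> \<subseteq> nsets X b" "cover_ge (Suc s) \<H>"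
    and y: "S0 \<in> \<H>" "y \<in> S0" and n: "2 \<le> b" "b + s \<le> a" "a + b \<le> card X"
    and R: "card (hitting (X - {y}) (a - 1) {S \<in> \<H>. y \<notin> S}) + card {S \<in> \<H>. y \<notin> S}
      \<le> hit_count b s (card X - 1) (a - 1) + s"
  shows "card (hitting X a \<H>) + card \<H> \<le> hit_count b (Suc s) (card X) a + Suc s"
    and "\<lbrakk>a + b < card X; s = 0 \<Longrightarrow> b < a; 2 \<le> card {S \<in> \<H>. y \<in> S}\<rbrakk>
      \<Longrightarrow> card (hitting X a \<H>) + card \<H> < hit_count b (Suc s) (card X) a + Suc s"
proof -
  obtain c where c: "b = Suc c" using n by (cases b) auto
  let ?Y = "X - {y}" and ?P = "(\<lambda>S. S - {y}) ` \<H>"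
  have S0: "S0 \<subseteq> X" "card S0 = b" using y H unfolding nsets_def by auto
  then have yX: "y \<in> X" using y by auto
  have cY: "card ?Y = card X - 1" and fY: "finite ?Y" using yX X by simp_all
  have sz: "sized X (Suc c) b \<H>" using sized_nsets(1)[OF H(1)] c by simp
  have szP: "sized ?Y c b ?P" by (rule sized_shrink[OF X sz])
  have covP: "cover_ge (Suc s) ?P" by (rule cover_ge_shrink[OF H(2)])
  have split: "card (hitting X a \<H>) + card \<H> =
      (card (hitting ?Y a ?P) + card {S \<in> ?P. card S = c})
      + (card (hitting ?Y (a - 1) {S \<in> \<H>. y \<notin> S}) + card {S \<in> \<H>. y \<notin> S})"
  proof -
    have "{S \<in> \<H>. card S = Suc c} = \<H>" "{S \<in> {S \<in> \<H>. y \<notin> S}. card S = Suc c} = {S \<in> \<H>. y \<notin> S}"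
      using sized_nsets(2)[OF H(1)] c by auto
    then show ?thesis using hitting_layer_split[OF X sz yX, of a] n by simp
  qed
  have hc: "hit_count b (Suc s) (card X) a = hit_count b s (card X - 1) (a - 1) + hit_count1 b c s (card ?Y) a"
    unfolding hit_count_Suc cY using hit_count1_Suc[of b c s "card X" a] c by simp
  have P: "card (hitting ?Y a ?P) + card {S \<in> ?P. card S = c} \<le> hit_count1 b c s (card ?Y) a + 1"
  proof (rule hitting_layer_le[OF fY szP covP])
    show "\<exists>S\<in>?P. card S = c" using y S0 c by (auto intro!: bexI[of _ S0])
  qed (use n c cY in auto)
  show "card (hitting X a \<H>) + card \<H> \<le> hit_count b (Suc s) (card X) a + Suc s"
    using split hc P R by linarith
  assume strict: "a + b < card X" "s = 0 \<Longrightarrow> b < a" "2 \<le> card {S \<in> \<H>. y \<in> S}"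
  have "{S \<in> \<H>. card S = Suc c \<and> y \<in> S} = {S \<in> \<H>. y \<in> S}" using sized_nsets(2)[OF H(1)] c by auto
  then have "2 \<le> card {S \<in> ?P. card S = c}" using card_shrink_layer[OF X sz, of y] strict by simp
  then have "card (hitting ?Y a ?P) + card {S \<in> ?P. card S = c} \<le> hit_count1 b c s (card ?Y) a"
    using strict n c cY by (intro hitting_layer_less[OF fY szP covP]) auto
  then show "card (hitting X a \<H>) + card \<H> < hit_count b (Suc s) (card X) a + Suc s"
    using split hc R by linarith
qed

lemma hit_count_one:
  assumes "b \<le> m" "1 \<le> a"
  shows "hit_count b (Suc 0) m a + ((m - b) choose a) = m choose a"
  unfolding hit_count_Suc using hit_count1_single[OF assms] .

text \<open>Supplies \<open>R\<close> of \<open>hitting_uniform_split\<close>. As \<open>y\<close>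
  lies in a hitting set \<open>A\<close>, the set \<open>A - {y}\<close> hits the remaining members,
  so \<open>IH\<close> applies to them. For \<open>s = 0\<close> double counting needs
  \<open>b \<le> a - 1\<close>, hence \<open>hm\<close>.\<close>

lemma hitting_remove_le:
  fixes X :: "'a set"
  assumes X: "finite X" and H: "\<H> \<subseteq> nsets X b" "cover_ge (Suc s) \<H>"
    and A: "A \<in> hitting X a \<H>" "y \<in> A" and n: "2 \<le> b" "b + s \<le> a" "a + b \<le> card X"
    and hm: "s = 0 \<Longrightarrow> b < a"
    and IH: "\<And>s' (Y :: 'a set) \<K>. \<lbrakk>s = Suc s'; finite Y; \<K> \<subseteq> nsets Y b; cover_ge (Suc s') \<K>;
      hitting Y (a - 1) \<K> \<noteq> {}; b + s' \<le> a - 1; a - 1 + b \<le> card Y\<rbrakk> \<Longrightarrow>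
      card (hitting Y (a - 1) \<K>) + card \<K> \<le> hit_count b (Suc s') (card Y) (a - 1) + Suc s'"
  shows "card (hitting (X - {y}) (a - 1) {S \<in> \<H>. y \<notin> S}) + card {S \<in> \<H>. y \<notin> S}
      \<le> hit_count b s (card X - 1) (a - 1) + s"
proof -
  let ?Y = "X - {y}" and ?Q = "{S \<in> \<H>. y \<notin> S}"
  have AX: "A \<subseteq> X" "finite A" "card A = a" using A unfolding hitting_def nsets_def by auto
  then have yX: "y \<in> X" using A by auto
  have cY: "card ?Y = card X - 1" and fY: "finite ?Y" using yX X by simp_all
  have Q: "?Q \<subseteq> nsets ?Y b" by (rule nsets_remove[OF H(1)])
  show ?thesis
  proof (cases s)
    case 0
    have "card (hitting ?Y (a - 1) ?Q) + card ?Q \<le> card ?Y choose (a - 1)"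
      using 0 hm n cY by (intro card_hitting_add_card_le[OF fY Q]) auto
    then show ?thesis using 0 cY by simp
  next
    case (Suc s')
    have "A - {y} \<in> hitting ?Y (a - 1) ?Q"
    proof -
      have "(A - {y}) \<inter> S \<noteq> {}" if "S \<in> \<H>" "y \<notin> S" for S
        using A(1) that unfolding hitting_def by blast
      then show ?thesis using AX A(2) unfolding hitting_def nsets_def by auto
    qed
    moreover have "cover_ge (Suc s') ?Q" using cover_ge_remove[OF H(2)] Suc by simp
    moreover have "b + s' \<le> a - 1" "a - 1 + b \<le> card ?Y" using n Suc cY by auto
    ultimately show ?thesis using IH[OF Suc fY Q] unfolding Suc cY by blast
  qed
qed

theorem hitting_uniform_le:
  assumes "finite X" "\<H> \<subseteq> nsets X b" "cover_ge (Suc s) \<H>" "hitting X a \<H> \<noteq> {}"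
    and "2 \<le> b" "b + s \<le> a" "a + b \<le> card X"
  shows "card (hitting X a \<H>) + card \<H> \<le> hit_count b (Suc s) (card X) a + Suc s"
  using assms
proof (induction s arbitrary: X \<H> a)
  case (0 X \<H> a)
  have ne: "\<H> \<noteq> {}" by (rule cover_ge_Suc_nonempty[OF 0(3)])
  have one: "hit_count b (Suc 0) (card X) a + ((card X - b) choose a) = card X choose a"
    using 0 by (intro hit_count_one) auto
  consider "b < a" | "b = a" "2 * a = card X" | "b = a" "2 * a < card X" using 0 by linarith
  then show ?case
  proof cases
    case 1
    obtain A S where AS: "A \<in> hitting X a \<H>" "S \<in> \<H>" using 0 ne by auto
    then obtain y where y: "y \<in> A" "y \<in> S" unfolding hitting_def by blast
    have "card (hitting (X - {y}) (a - 1) {S \<in> \<H>. y \<notin> S}) + card {S \<in> \<H>. y \<notin> S}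
      \<le> hit_count b 0 (card X - 1) (a - 1) + 0"
      using 0 1 by (intro hitting_remove_le[OF 0(1-3) AS(1) y(1)]) auto
    then show ?thesis using 0 by (intro hitting_uniform_split(1)[OF 0(1-3) AS(2) y(2)]) auto
  next
    case 2
    have "card (hitting X a \<H>) + card \<H> \<le> card X choose a"
      using 0 2 by (intro card_hitting_add_card_le[of X \<H> b]) auto
    moreover have "(card X - b) choose a = 1" using 2 by (simp flip: 2(2))
    ultimately show ?thesis using one by linarith
  next
    case 3
    have "pair_size X a \<H> + ((card X - a) choose a) \<le> (card X choose a) + 1"
      using 0 3 ne by (intro pair_size_le(1)) auto
    then show ?thesis using one 3 unfolding pair_size_def by simp
  qed
next
  case (Suc s X \<H> a)
  have ne: "\<H> \<noteq> {}" by (rule cover_ge_Suc_nonempty[OF Suc.prems(3)])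
  obtain A S where AS: "A \<in> hitting X a \<H>" "S \<in> \<H>" using Suc.prems ne by auto
  then obtain y where y: "y \<in> A" "y \<in> S" unfolding hitting_def by blast
  have "card (hitting (X - {y}) (a - 1) {S \<in> \<H>. y \<notin> S}) + card {S \<in> \<H>. y \<notin> S}
      \<le> hit_count b (Suc s) (card X - 1) (a - 1) + Suc s"
  proof (rule hitting_remove_le[OF Suc.prems(1-3) AS(1) y(1) Suc.prems(5-7)])
    fix s' and Y :: "'a set" and \<K>
    assume "Suc s = Suc s'" "finite Y" "\<K> \<subseteq> nsets Y b" "cover_ge (Suc s') \<K>"
      "hitting Y (a - 1) \<K> \<noteq> {}" "b + s' \<le> a - 1" "a - 1 + b \<le> card Y"
    then show "card (hitting Y (a - 1) \<K>) + card \<K> \<le> hit_count b (Suc s') (card Y) (a - 1) + Suc s'"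
      using Suc.IH[of Y \<K> "a - 1"] Suc.prems(5) by blast
  qed simp
  then show ?case
    using Suc.prems by (intro hitting_uniform_split(1)[OF Suc.prems(1-3) AS(2) y(2)]) auto
qed

section \<open>Structure of the families attaining equality\<close>

lemma cover_ge_disjoint:
  assumes "finite \<H>" "disjoint \<H>" "t \<le> card \<H>"
  shows "cover_ge t \<H>"
  unfolding cover_ge_def
proof (intro allI impI, rule ccontr)
  fix T :: "'a set" assume T: "finite T \<and> card T < t" and "\<not> (\<exists>S\<in>\<H>. T \<inter> S = {})"
  then have "\<forall>S\<in>\<H>. \<exists>x. x \<in> T \<inter> S" by auto
  then obtain f where f: "\<And>S. S \<in> \<H> \<Longrightarrow> f S \<in> T \<inter> S" by metis
  have "inj_on f \<H>"
  proof (rule inj_onI)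
    fix S S' assume "S \<in> \<H>" "S' \<in> \<H>" "f S = f S'"
    then have "f S \<in> S \<inter> S'" using f by force
    then show "S = S'" using assms(2) \<open>S \<in> \<H>\<close> \<open>S' \<in> \<H>\<close> unfolding disjoint_def by auto
  qed
  then have "card \<H> \<le> card T" using f T by (intro card_inj_on_le[of f]) auto
  then show False using T assms(3) by simp
qed

lemma cover_ge_card:
  assumes "finite \<H>" "{} \<notin> \<H>" "cover_ge t \<H>"
  shows "t \<le> card \<H>"
proof (rule ccontr)
  assume "\<not> t \<le> card \<H>"
  have "\<forall>S\<in>\<H>. \<exists>x. x \<in> S" using assms(2) by (metis ex_in_conv)
  then obtain f where f: "\<And>S. S \<in> \<H> \<Longrightarrow> f S \<in> S" by metis
  have "card (f ` \<H>) < t" using card_image_le[OF assms(1), of f] \<open>\<not> t \<le> card \<H>\<close> by simp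
  then obtain S where "S \<in> \<H>" "f ` \<H> \<inter> S = {}"
    using assms(1,3) unfolding cover_ge_def by blast
  then show False using f by auto
qed

text \<open>Replacing the \<open>k\<close> points of \<open>A \<inter> S\<close> by \<open>k\<close>
  points outside \<open>S \<union> A\<close> gives sets that miss \<open>S\<close> but still hit the
  other members, since these are disjoint from \<open>S\<close>. At least \<open>k + 1\<close>
  points are available because \<open>a + b < card X\<close>, hence at least two choices.\<close>

lemma hitting_remove_member:
  assumes X: "finite X" and H: "\<H> \<subseteq> nsets X b" "disjoint \<H>" "S \<in> \<H>"
    and ne: "hitting X a \<H> \<noteq> {}" and n: "a + b < card X"
  shows "card (hitting X a \<H>) + 2 \<le> card (hitting X a (\<H> - {S}))"
proof -
  obtain A where A: "A \<in> hitting X a \<H>" using ne by auto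
  then have AX: "A \<subseteq> X" "finite A" "card A = a" and AS: "A \<inter> S \<noteq> {}"
    using H unfolding hitting_def nsets_def by auto
  have S: "S \<subseteq> X" "finite S" "card S = b" using H unfolding nsets_def by auto
  define k where "k = card (A \<inter> S)"
  have k1: "1 \<le> k" using AS AX by (auto simp: k_def Suc_le_eq card_gt_0_iff)
  let ?W = "X - (S \<union> A)"
  have "card (S \<union> A) + k = a + b" using card_Un_Int[of S A] S AX by (simp add: k_def Int_commute)
  moreover have "card ?W = card X - card (S \<union> A)" using S AX by (intro card_Diff_subset) auto
  ultimately have W: "Suc k \<le> card ?W" using n by linarith
  have fW: "finite ?W" using X by simp
  let ?E = "(\<lambda>U. (A - S) \<union> U) ` nsets ?W k"
  have "inj_on (\<lambda>U. (A - S) \<union> U) (nsets ?W k)"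
  proof (rule inj_onI)
    fix U V assume UV: "U \<in> nsets ?W k" "V \<in> nsets ?W k" and eq: "(A - S) \<union> U = (A - S) \<union> V"
    have "U \<inter> A = {}" "V \<inter> A = {}" using UV unfolding nsets_def by auto
    then have "U = ((A - S) \<union> U) - A" "V = ((A - S) \<union> V) - A" by auto
    then show "U = V" using eq by simp
  qed
  then have "card ?E = card ?W choose k" using card_nsets[OF fW] by (simp add: card_image)
  also have "\<dots> \<ge> card ?W" using k1 W by (intro binomial_ge_top) auto
  finally have cE: "2 \<le> card ?E" using k1 W by linarith
  have "?E \<subseteq> hitting X a (\<H> - {S})"
  proof
    fix E assume "E \<in> ?E"
    then obtain U where U: "E = (A - S) \<union> U" "U \<subseteq> ?W" "finite U" "card U = k" unfolding nsets_def by auto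
    have "card (A - S) + k = a"
      using card_Un_disjoint[of "A - S" "A \<inter> S"] AX k_def by (simp add: Un_commute Int_Diff_Un Diff_Int2 disjoint_iff Un_Diff_Int)
    moreover have "card E = card (A - S) + card U" unfolding U(1) using U AX by (intro card_Un_disjoint) auto
    ultimately have "E \<in> nsets X a" using U AX unfolding nsets_def by auto
    moreover have "E \<inter> S' \<noteq> {}" if "S' \<in> \<H> - {S}" for S'
    proof -
      have "S' \<inter> S = {}" using that H unfolding disjoint_def by auto
      moreover have "A \<inter> S' \<noteq> {}" using A that unfolding hitting_def by auto
      ultimately show ?thesis using U(1) by blast
    qed
    ultimately show "E \<in> hitting X a (\<H> - {S})" unfolding hitting_def by auto
  qed
  moreover have "hitting X a \<H> \<subseteq> hitting X a (\<H> - {S})" by (intro hitting_antimono) auto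
  ultimately have sub: "hitting X a \<H> \<union> ?E \<subseteq> hitting X a (\<H> - {S})" by auto
  have "E \<inter> S = {}" if "E \<in> ?E" for E using that unfolding nsets_def by auto
  then have dis: "hitting X a \<H> \<inter> ?E = {}" using H(3) unfolding hitting_def by blast
  have "card (hitting X a \<H>) + card ?E = card (hitting X a \<H> \<union> ?E)"
    using dis finite_hitting[OF X] fW by (simp add: card_Un_disjoint finite_imp_finite_nsets)
  also have "\<dots> \<le> card (hitting X a (\<H> - {S}))"
    using sub by (intro card_mono finite_hitting[OF X])
  finally show ?thesis using cE by linarith
qed

theorem hitting_uniform_eq:
  assumes X: "finite X" and H: "\<H> \<subseteq> nsets X b" "cover_ge (Suc s) \<H>"
    and ne: "hitting X a \<H> \<noteq> {}"
    and n: "2 \<le> b" "b + s \<le> a" "a + b < card X" and hm: "s = 0 \<Longrightarrow> b < a"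
    and eq: "card (hitting X a \<H>) + card \<H> = hit_count b (Suc s) (card X) a + Suc s"
  shows "disjoint \<H>" and "card \<H> = Suc s"
proof -
  have fH: "finite \<H>" using H(1) X finite_imp_finite_nsets finite_subset by blast
  \<comment> \<open>A point of a hitting set shared by two members would make the bound
    strict.\<close>
  have uniq: "S = S'" if A: "A \<in> hitting X a \<H>" "y \<in> A" and S: "S \<in> \<H>" "S' \<in> \<H>" "y \<in> S" "y \<in> S'" for A y S S'
  proof (rule ccontr)
    assume "S \<noteq> S'"
    have "card {S, S'} \<le> card {S \<in> \<H>. y \<in> S}" using S fH by (intro card_mono) auto
    then have two: "2 \<le> card {S \<in> \<H>. y \<in> S}" using \<open>S \<noteq> S'\<close> by simp
    have "card (hitting (X - {y}) (a - 1) {S \<in> \<H>. y \<notin> S}) + card {S \<in> \<H>. y \<notin> S}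
      \<le> hit_count b s (card X - 1) (a - 1) + s"
      using n hm by (intro hitting_remove_le[OF X H A] hitting_uniform_le) auto
    then show False
      using hitting_uniform_split(2)[OF X H S(1,3) n(1,2) _ _ n(3) hm two] eq n by auto
  qed
  obtain A where A: "A \<in> hitting X a \<H>" using ne by auto
  then have AX: "A \<subseteq> X" "finite A" "card A = a" unfolding hitting_def nsets_def by auto
  show dis: "disjoint \<H>"
    unfolding disjoint_def
  proof (intro ballI impI, rule ccontr)
    fix S S' assume S: "S \<in> \<H>" "S' \<in> \<H>" "S \<noteq> S'" "S \<inter> S' \<noteq> {}"
    then obtain x where x: "x \<in> S" "x \<in> S'" by auto
    obtain z where z: "z \<in> A" "z \<in> S" using A S unfolding hitting_def by blast
    have "x \<notin> A" using uniq[OF A _ S(1,2) x] S(3) by auto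
    \<comment> \<open>By \<open>uniq\<close>, \<open>S\<close> is the only member through
      \<open>z\<close>, and \<open>x\<close> hits it as well; so the exchanged set is again hitting
      and contains the shared point \<open>x\<close>.\<close>
    let ?A = "insert x (A - {z})"
    have "?A \<in> nsets X a"
    proof -
      have "x \<in> X" using x S H(1) unfolding nsets_def by auto
      then show ?thesis using AX z \<open>x \<notin> A\<close> card_Suc_Diff1[OF AX(2) z(1)] unfolding nsets_def by auto
    qed
    moreover have "?A \<inter> R \<noteq> {}" if R: "R \<in> \<H>" for R
    proof (cases "R = S")
      case False
      then have "z \<notin> R" using uniq[OF A z(1) R S(1)] z by auto
      moreover have "A \<inter> R \<noteq> {}" using A R unfolding hitting_def by auto
      ultimately show ?thesis by blast
    qed (use x in auto)
    ultimately have "?A \<in> hitting X a \<H>" unfolding hitting_def by auto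
    then show False using uniq[of ?A x S S'] S x by auto
  qed
  show "card \<H> = Suc s"
  proof (rule antisym)
    have "{} \<notin> \<H>" using H(1) n unfolding nsets_def by auto
    then show "Suc s \<le> card \<H>" using cover_ge_card[OF fH _ H(2)] by simp
    show "card \<H> \<le> Suc s"
    proof (rule ccontr)
      \<comment> \<open>By disjointness, dropping one member leaves covering number at least
        \<open>Suc s\<close>. It gains two or more hitting sets for the one member lost, which
        exceeds the bound.\<close>
      assume gt: "\<not> card \<H> \<le> Suc s"
      then obtain S where S: "S \<in> \<H>" by fastforce
      let ?K = "\<H> - {S}"
      have cK: "card \<H> = Suc (card ?K)" using S fH by (metis card_Suc_Diff1)
      have "disjoint ?K" using dis unfolding disjoint_def by auto
      then have "cover_ge (Suc s) ?K" using gt cK fH by (intro cover_ge_disjoint) auto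
      moreover have "hitting X a ?K \<noteq> {}" using A hitting_antimono[of ?K \<H> X a] by auto
      ultimately have "card (hitting X a ?K) + card ?K \<le> hit_count b (Suc s) (card X) a + Suc s"
        using H(1) n by (intro hitting_uniform_le[OF X]) auto
      then show False
        using hitting_remove_member[OF X H(1) dis S ne n(3)] eq cK by linarith
    qed
  qed
qed

section \<open>Disjoint blocks\<close>

text \<open>Inclusion-exclusion over the missed blocks; the term \<open>i = 0\<close> is the
  separate \<open>n choose a\<close> of the theorem.\<close>

definition sieve_count :: "nat \<Rightarrow> nat \<Rightarrow> nat \<Rightarrow> nat \<Rightarrow> int" where
  "sieve_count b s m a = (\<Sum>i\<le>s. (-1) ^ i * int (s choose i) * int ((m - i * b) choose a))"

lemma alternating_binomial_Suc:
  fixes f :: "nat \<Rightarrow> int"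
  shows "(\<Sum>i\<le>Suc s. (-1) ^ i * int (Suc s choose i) * f i) =
    (\<Sum>i\<le>s. (-1) ^ i * int (s choose i) * f i) - (\<Sum>i\<le>s. (-1) ^ i * int (s choose i) * f (Suc i))"
proof -
  have "(\<Sum>i\<le>s. (-1) ^ i * int (s choose i) * f i) = (\<Sum>i\<le>Suc s. (-1) ^ i * int (s choose i) * f i)"
    by simp
  also have "\<dots> = f 0 - (\<Sum>i\<le>s. (-1) ^ i * int (s choose Suc i) * f (Suc i))"
    unfolding sum.atMost_Suc_shift by (simp add: sum_negf)
  finally have 1: "(\<Sum>i\<le>s. (-1) ^ i * int (s choose i) * f i)
      = f 0 - (\<Sum>i\<le>s. (-1) ^ i * int (s choose Suc i) * f (Suc i))" .
  have "(\<Sum>i\<le>Suc s. (-1) ^ i * int (Suc s choose i) * f i)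
      = f 0 - (\<Sum>i\<le>s. (-1) ^ i * int (Suc s choose Suc i) * f (Suc i))"
    unfolding sum.atMost_Suc_shift by (simp add: sum_negf)
  also have "(\<Sum>i\<le>s. (-1) ^ i * int (Suc s choose Suc i) * f (Suc i))
      = (\<Sum>i\<le>s. (-1) ^ i * int (s choose i) * f (Suc i)) + (\<Sum>i\<le>s. (-1) ^ i * int (s choose Suc i) * f (Suc i))"
    by (simp add: sum.distrib[symmetric] algebra_simps)
  finally show ?thesis using 1 by simp
qed

lemma sieve_count_Suc: "sieve_count b (Suc s) m a = sieve_count b s m a - sieve_count b s (m - b) a"
  unfolding sieve_count_def
  using alternating_binomial_Suc[of s "\<lambda>i. int ((m - i * b) choose a)"] by simp

text \<open>Pascal's rule in every term. The strict inequality \<open>s * b < m\<close> keeps each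
  \<open>m - i * b\<close> positive despite truncated subtraction.\<close>

lemma sieve_count_pascal:
  assumes "s * b < m" "0 < a"
  shows "sieve_count b s m a = sieve_count b s (m - 1) (a - 1) + sieve_count b s (m - 1) a"
proof -
  have "int ((m - i * b) choose a) = int ((m - 1 - i * b) choose (a - 1)) + int ((m - 1 - i * b) choose a)"
    if "i \<le> s" for i
  proof -
    have "i * b \<le> s * b" using that by simp
    then obtain k where k: "m - i * b = Suc k" "m - 1 - i * b = k"
      using assms(1) by (metis Suc_diff_Suc diff_commute diff_Suc_1 le_less_trans)
    obtain a' where "a = Suc a'" using assms(2) by (cases a) auto
    then show ?thesis using k by simp
  qed
  then show ?thesis
    unfolding sieve_count_def by (simp add: sum.distrib[symmetric] distrib_left[symmetric])
qed

lemma hit_count_eq_sieve_count: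
  assumes "s \<le> a" "s * b \<le> m"
  shows "int (hit_count b s m a) = sieve_count b s m a"
  using assms
proof (induction s arbitrary: m a)
  case 0
  then show ?case by (simp add: sieve_count_def)
next
  case (Suc s)
  note IH = Suc.IH
  \<comment> \<open>The sum over the points of a block telescopes: by Pascal's rule each summand is
    a difference of two sieve values.\<close>
  have "int (hit_count1 b c s m a) = sieve_count b s m a - sieve_count b s (m - c) a"
    if "s * b + c \<le> m" for c m
    using that
  proof (induction c arbitrary: m)
    case (Suc c)
    have "int (hit_count b s (m - 1) (a - 1)) = sieve_count b s (m - 1) (a - 1)"
      using Suc.prems \<open>Suc s \<le> a\<close> by (intro IH) auto
    moreover have "int (hit_count1 b c s (m - 1) a)
        = sieve_count b s (m - 1) a - sieve_count b s (m - 1 - c) a"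
      using Suc.prems by (intro Suc.IH) auto
    moreover have "sieve_count b s m a = sieve_count b s (m - 1) (a - 1) + sieve_count b s (m - 1) a"
      using Suc.prems \<open>Suc s \<le> a\<close> by (intro sieve_count_pascal) auto
    ultimately show ?case by (simp add: hit_count1_Suc)
  qed simp
  from this[of b m] show ?case unfolding hit_count_Suc sieve_count_Suc using Suc.prems by simp
qed

text \<open>A set hitting the other blocks either hits the new block \<open>B\<close> or lies in
  \<open>X - B\<close>; this is the recursion \<open>sieve_count_Suc\<close>.\<close>

lemma card_hitting_disjoint:
  assumes "finite X" "\<H> \<subseteq> nsets X b" "finite \<H>" "disjoint \<H>"
  shows "int (card (hitting X a \<H>)) = sieve_count b (card \<H>) (card X) a"
  using assms(3,1,2,4)
proof (induction \<H> arbitrary: X)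
  case empty
  then show ?case by (simp add: hitting_def sieve_count_def card_nsets)
next
  case (insert B \<H>)
  have B: "B \<subseteq> X" "finite B" "card B = b" using insert.prems unfolding nsets_def by auto
  have sub: "\<H> \<subseteq> nsets (X - B) b"
  proof
    fix S assume S: "S \<in> \<H>"
    then have "S \<inter> B = {}" using insert unfolding disjoint_def by auto
    then show "S \<in> nsets (X - B) b" using S insert.prems unfolding nsets_def by auto
  qed
  have dis: "disjoint \<H>" using insert.prems unfolding disjoint_def by auto
  have "hitting X a \<H> = hitting X a (insert B \<H>) \<union> hitting (X - B) a \<H>"
    unfolding hitting_def nsets_def by auto
  moreover have "hitting X a (insert B \<H>) \<inter> hitting (X - B) a \<H> = {}"
    unfolding hitting_def nsets_def by auto
  ultimately have "card (hitting X a \<H>) = card (hitting X a (insert B \<H>)) + card (hitting (X - B) a \<H>)"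
    using insert.prems(1) by (metis card_Un_disjoint finite_Diff finite_hitting)
  moreover have "int (card (hitting X a \<H>)) = sieve_count b (card \<H>) (card X) a"
    using insert.IH[of X] insert.prems dis by auto
  moreover have "int (card (hitting (X - B) a \<H>)) = sieve_count b (card \<H>) (card X - b) a"
    using insert.IH[of "X - B"] insert.prems(1) sub dis B by (simp add: card_Diff_subset)
  ultimately show ?case using insert.hyps by (simp add: sieve_count_Suc)
qed

section \<open>Transport of disjoint families by permutations\<close>

text \<open>Three kinds of bijections are glued: between the families, between each member and its
  partner, and between the complements of the unions, which have equal size.\<close>

lemma disjoint_families_permutes:
  assumes X: "finite X" and H: "\<H> \<subseteq> nsets X b" "disjoint \<H>" and K: "\<K> \<subseteq> nsets X b" "disjoint \<K>"
    and card: "card \<H> = card \<K>"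
  obtains \<pi> where "\<pi> permutes X" "(`) \<pi> ` \<H> = \<K>"
proof -
  have fin: "finite \<H>" "finite \<K>" using H(1) K(1) X finite_imp_finite_nsets finite_subset by blast+
  then obtain f where f: "bij_betw f \<H> \<K>" using card finite_same_card_bij by blast
  then have fK: "f S \<in> \<K>" if "S \<in> \<H>" for S using that bij_betwE by blast
  have "\<exists>g. bij_betw g S (f S)" if "S \<in> \<H>" for S
    using that fK[OF that] H(1) K(1) unfolding nsets_def by (intro finite_same_card_bij) auto
  then obtain g where g: "\<And>S. S \<in> \<H> \<Longrightarrow> bij_betw (g S) S (f S)" by metis
  \<comment> \<open>Disjointness makes the member through a point of the union unique.\<close>
  define h where "h x = g (THE S. S \<in> \<H> \<and> x \<in> S) x" for x
  have h: "bij_betw h S (f S)" if S: "S \<in> \<H>" for S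
  proof -
    have "h x = g S x" if "x \<in> S" for x
    proof -
      have "(THE S. S \<in> \<H> \<and> x \<in> S) = S"
        using S that H(2) unfolding disjoint_def by (intro the_equality) auto
      then show ?thesis unfolding h_def by simp
    qed
    then show ?thesis using g[OF S] bij_betw_cong[of S h "g S" "f S"] by simp
  qed
  have imf: "f ` \<H> = \<K>" using f by (rule bij_betw_imp_surj_on)
  have "disjoint_family_on f \<H>"
    unfolding disjoint_family_on_def
  proof (intro ballI impI)
    fix S S' assume S: "S \<in> \<H>" "S' \<in> \<H>" "S \<noteq> S'"
    then have "f S \<noteq> f S'" using f unfolding bij_betw_def inj_on_def by blast
    then show "f S \<inter> f S' = {}" using K(2) fK S unfolding disjoint_def by blast
  qed
  then have U: "bij_betw h (\<Union>\<H>) (\<Union>\<K>)"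
    using bij_betw_UNION_disjoint[of f \<H> h "\<lambda>S. S"] h imf by simp
  have sub: "\<Union>\<H> \<subseteq> X" "\<Union>\<K> \<subseteq> X" using H(1) K(1) unfolding nsets_def by auto
  have fU: "finite (\<Union>\<H>)" "finite (\<Union>\<K>)" using sub X by (auto intro: finite_subset)
  have "card (X - \<Union>\<H>) = card (X - \<Union>\<K>)"
    using bij_betw_same_card[OF U] sub fU by (simp add: card_Diff_subset)
  then obtain q where q: "bij_betw q (X - \<Union>\<H>) (X - \<Union>\<K>)"
    using X finite_same_card_bij by blast
  define \<pi> where "\<pi> x = (if x \<in> \<Union>\<H> then h x else if x \<in> X then q x else x)" for x
  have "bij_betw (\<lambda>x. if x \<in> \<Union>\<H> then h x else q x) (\<Union>\<H> \<union> (X - \<Union>\<H>)) (\<Union>\<K> \<union> (X - \<Union>\<K>))"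
    using U q by (intro bij_betw_disjoint_Un) auto
  moreover have "\<Union>\<H> \<union> (X - \<Union>\<H>) = X" "\<Union>\<K> \<union> (X - \<Union>\<K>) = X" using sub by auto
  ultimately have "bij_betw (\<lambda>x. if x \<in> \<Union>\<H> then h x else q x) X X" by simp
  then have "bij_betw \<pi> X X" by (rule bij_betw_cong[THEN iffD1, rotated]) (simp add: \<pi>_def)
  then have "\<pi> permutes X" using sub by (intro bij_imp_permutes) (auto simp: \<pi>_def)
  moreover have "\<pi> ` S = f S" if S: "S \<in> \<H>" for S
  proof -
    have "\<pi> ` S = h ` S" using S by (intro image_cong) (auto simp: \<pi>_def)
    then show ?thesis using h[OF S] by (simp add: bij_betw_def)
  qed
  then have "(`) \<pi> ` \<H> = \<K>" using imf by (metis (no_types, lifting) image_cong)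
  ultimately show ?thesis by (rule that)
qed

text \<open>\<open>cover_ge\<close> ranges over all finite sets, \<open>covering_number\<close> only
  over subsets of \<open>{1..n}\<close>; a small cover is therefore cut down to
  \<open>{1..n}\<close>.\<close>

lemma covering_number_imp_cover_ge:
  assumes "\<G> \<subseteq> nsets {1..n} b" "t \<le> covering_number n \<G>"
  shows "cover_ge t \<G>"
  unfolding cover_ge_def
proof (intro allI impI, rule ccontr)
  fix T :: "nat set" assume T: "finite T \<and> card T < t" and no: "\<not> (\<exists>S\<in>\<G>. T \<inter> S = {})"
  let ?\<T> = "{T. T \<subseteq> {1..n} \<and> (\<forall>F\<in>\<G>. T \<inter> F \<noteq> {})}"
  have fin: "finite (card ` ?\<T>)"
    by (intro finite_imageI finite_subset[of ?\<T> "Pow {1..n}"]) auto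
  have "T \<inter> {1..n} \<inter> F \<noteq> {}" if "F \<in> \<G>" for F
  proof -
    have "T \<inter> F \<noteq> {}" "F \<subseteq> {1..n}" using no that assms(1) unfolding nsets_def by auto
    then show ?thesis by auto
  qed
  then have "T \<inter> {1..n} \<in> ?\<T>" by auto
  then have "covering_number n \<G> \<le> card (T \<inter> {1..n})"
    unfolding covering_number_def using fin by (intro Min_le) auto
  also have "\<dots> \<le> card T" using T by (intro card_mono) auto
  finally show False using T assms(2) by simp
qed

lemma M_family_eq: "M_family n a t B = B ` {1..t} \<union> hitting {1..n} a (B ` {1..t})"
  unfolding M_family_def hitting_def by auto

lemma disjoint_blocks_family:
  assumes "disjoint_blocks n b t B" "0 < b"
  shows "B ` {1..t} \<subseteq> nsets {1..n} b" "disjoint (B ` {1..t})" "card (B ` {1..t}) = t"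
proof -
  have B: "B i \<in> nsets {1..n} b" if "i \<in> {1..t}" for i
    using assms that unfolding disjoint_blocks_def by auto
  have dis: "B i \<inter> B j = {}" if "i \<in> {1..t}" "j \<in> {1..t}" "i \<noteq> j" for i j
    using assms that unfolding disjoint_blocks_def disjoint_family_on_def by auto
  show "B ` {1..t} \<subseteq> nsets {1..n} b" using B by auto
  show "disjoint (B ` {1..t})" unfolding disjoint_def using dis by blast
  have "inj_on B {1..t}"
  proof (rule inj_onI, rule ccontr)
    fix i j assume ij: "i \<in> {1..t}" "j \<in> {1..t}" "B i = B j" "i \<noteq> j"
    then have "B i = {}" using dis by fastforce
    then show False using B[OF ij(1)] assms(2) unfolding nsets_def by auto
  qed
  then show "card (B ` {1..t}) = t" by (simp add: card_image)
qed

lemma isomorphic_M_family: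
  assumes "disjoint_blocks n b t B" "0 < b"
    and "\<H> \<subseteq> nsets {1..n} b" "disjoint \<H>" "card \<H> = t"
  shows "isomorphic_families n (\<H> \<union> hitting {1..n} a \<H>) (M_family n a t B)"
proof -
  note B = disjoint_blocks_family[OF assms(1,2)]
  obtain \<pi> where \<pi>: "\<pi> permutes {1..n}" "(`) \<pi> ` \<H> = B ` {1..t}"
    using disjoint_families_permutes[OF finite_atLeastAtMost assms(3,4) B(1,2)] B(3) assms(5) by metis
  then have "(`) \<pi> ` (\<H> \<union> hitting {1..n} a \<H>) = M_family n a t B"
    using hitting_image_permutes[OF \<pi>(1), of a \<H>] unfolding M_family_eq image_Un by simp
  then show ?thesis using \<pi>(1) unfolding isomorphic_families_def by blast
qed

lemma Un_eq_Un_by_card: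
  assumes "\<P> \<union> \<Q> = \<R> \<union> \<T>" and a: "\<And>S. S \<in> \<P> \<union> \<T> \<Longrightarrow> card S = a"
    and b: "\<And>S. S \<in> \<Q> \<union> \<R> \<Longrightarrow> card S = b" and "a \<noteq> b"
  shows "\<P> = \<T> \<and> \<Q> = \<R>"
proof -
  have "\<P> = {S \<in> \<R> \<union> \<T>. card S = a}" "\<Q> = {S \<in> \<R> \<union> \<T>. card S = b}"
    unfolding assms(1)[symmetric] using a b \<open>a \<noteq> b\<close> by auto
  moreover have "\<T> = {S \<in> \<R> \<union> \<T>. card S = a}" "\<R> = {S \<in> \<R> \<union> \<T>. card S = b}"
    using a b \<open>a \<noteq> b\<close> by auto
  ultimately show ?thesis by simp
qed

theorem theorem7:
  fixes n a b t :: nat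
    and \<F> \<G> :: "nat set set"
  assumes "n > 0" and "a > 0" and "t > 0"
    and "b \<ge> 2" and "a \<ge> b + t - 1" and "n \<ge> max (a + b) (b * t)"
    and "\<F> \<subseteq> nsets {1..n} a" and "\<G> \<subseteq> nsets {1..n} b"
    and "cross_intersecting \<F> \<G>"
    and "covering_number n \<F> \<ge> 1" and "covering_number n \<G> \<ge> t"
  shows
    "int (card \<F>) + int (card \<G>) \<le>
       int (n choose a)
       + (\<Sum>i=1..t. (-1) ^ i * int (t choose i) * int ((n - i * b) choose a)) + int t
     \<and> (n > a + b \<and> \<not> (a = 2 \<and> b = 2) \<longrightarrow>
         (\<forall>B. disjoint_blocks n b t B \<longrightarrow>
           (int (card \<F>) + int (card \<G>) =
              int (n choose a)
              + (\<Sum>i=1..t. (-1) ^ i * int (t choose i) * int ((n - i * b) choose a)) + int t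
            \<longleftrightarrow>
            isomorphic_families n (\<F> \<union> \<G>) (M_family n a t B) \<and> (a = b \<longrightarrow> \<F> \<inter> \<G> \<noteq> {}))))"
proof -
  let ?X = "{1..n}"
  let ?hit = "hitting ?X a \<G>"
  obtain s where s: "t = Suc s" using assms(3) by (cases t) auto
  have num: "2 \<le> b" "b + s \<le> a" "a + b \<le> card ?X" "t \<le> a" "t * b \<le> n"
    using assms(4-6) s by (auto simp: mult.commute)
  have fX: "finite ?X" by simp
  have fG: "finite \<G>" and fF: "finite \<F>"
    using assms(7,8) finite_imp_finite_nsets[OF fX] finite_subset by blast+
  have cov: "cover_ge (Suc s) \<G>" using covering_number_imp_cover_ge[OF assms(8,11)] s by simp
  have Fne: "\<F> \<noteq> {}"
    using cover_ge_Suc_nonempty[of 0 \<F>] covering_number_imp_cover_ge[OF assms(7,10)] by simp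
  have Fhit: "\<F> \<subseteq> ?hit"
    using assms(7,9) unfolding cross_intersecting_def hitting_def by auto
  then have ne: "?hit \<noteq> {}" using Fne by auto
  have cF: "card \<F> \<le> card ?hit" using Fhit by (intro card_mono finite_hitting[OF fX])
  have bound: "card ?hit + card \<G> \<le> hit_count b (Suc s) (card ?X) a + Suc s"
    by (rule hitting_uniform_le[OF fX assms(8) cov ne num(1-3)])
  have closed: "int (n choose a)
       + (\<Sum>i=1..t. (-1) ^ i * int (t choose i) * int ((n - i * b) choose a)) = sieve_count b t n a"
    unfolding sieve_count_def atMost_atLeast0 by (simp add: sum.atLeast_Suc_atMost)
  have hc: "int (hit_count b (Suc s) (card ?X) a) = sieve_count b t n a"
    using hit_count_eq_sieve_count[OF num(4,5)] s by simp
  have le: "int (card \<F>) + int (card \<G>) \<le> sieve_count b t n a + int t"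
    using cF bound hc s by linarith
  have eq_iff: "int (card \<F>) + int (card \<G>) = sieve_count b t n a + int t \<longleftrightarrow>
      isomorphic_families n (\<F> \<union> \<G>) (M_family n a t B) \<and> (a = b \<longrightarrow> \<F> \<inter> \<G> \<noteq> {})"
    if n: "n > a + b" and exc: "\<not> (a = 2 \<and> b = 2)" and B: "disjoint_blocks n b t B" for B
  proof
    have b0: "0 < b" using num by simp
    note iso = isomorphic_M_family[OF B b0]
    assume eq: "int (card \<F>) + int (card \<G>) = sieve_count b t n a + int t"
    \<comment> \<open>Equality forces \<open>\<F>\<close> to be all of \<open>?hit\<close>, and the
      pair of \<open>?hit\<close> and \<open>\<G>\<close> to attain the bound.\<close>
    then have eqn: "card ?hit + card \<G> = hit_count b (Suc s) (card ?X) a + Suc s"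
      and "card \<F> = card ?hit" using cF bound hc s by linarith+
    then have F: "\<F> = ?hit" using Fhit finite_hitting[OF fX] by (intro card_subset_eq) auto
    consider "s = 0 \<longrightarrow> b < a" | "s = 0" "a = b" using num by linarith
    then show "isomorphic_families n (\<F> \<union> \<G>) (M_family n a t B) \<and> (a = b \<longrightarrow> \<F> \<inter> \<G> \<noteq> {})"
    proof cases
      case 1
      then have "disjoint \<G>" "card \<G> = t"
        using hitting_uniform_eq[OF fX assms(8) cov ne num(1,2) _ _ eqn] n s by auto
      moreover have "a \<noteq> b" using 1 num(2) by auto
      ultimately show ?thesis using iso[OF assms(8), of a] F by (simp add: Un_commute)
    next
      case 2
      have a3: "3 \<le> a" using exc 2 num(1) by auto
      have Ga: "\<G> \<subseteq> nsets ?X a" using assms(8) 2 by simp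
      have "hit_count b (Suc 0) (card ?X) a + ((card ?X - b) choose a) = card ?X choose a"
        using num assms(2) by (intro hit_count_one) auto
      then have eq': "pair_size ?X a \<G> + ((card ?X - a) choose a) = (card ?X choose a) + 1"
        using eqn 2 unfolding pair_size_def by simp
      have "card \<G> = 1 \<or> card ?hit = 1"
        using pair_size_le(2)[OF fX _ _ Ga _ ne a3 eq'] n 2 num(1) cover_ge_Suc_nonempty[OF cov] by auto
      then show ?thesis
      proof
        assume G1: "card \<G> = 1"
        then obtain C where C: "\<G> = {C}" by (auto simp: card_1_singleton_iff)
        then have "C \<in> \<F>" using F Ga num(1) 2 unfolding hitting_def nsets_def by auto
        moreover have "isomorphic_families n (\<G> \<union> \<F>) (M_family n a t B)"
          unfolding F using C G1 s 2 by (intro iso[OF assms(8)]) auto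
        ultimately show ?thesis using C by (auto simp: Un_commute)
      next
        \<comment> \<open>The roles are interchanged: \<open>\<F>\<close> is the single block and
          \<open>\<G>\<close> consists of the sets hitting it.\<close>
        assume hit1: "card ?hit = 1"
        then obtain C where C: "\<F> = {C}" using F by (auto simp: card_1_singleton_iff)
        have CX: "C \<in> nsets ?X a" using C assms(7) by auto
        have sub: "\<G> \<subseteq> hitting ?X a {C}" using subset_hitting_hitting[OF Ga, of a] F C by simp
        have "card \<G> = card (hitting ?X a {C})"
          using eq' pair_size_singleton[OF fX CX] hit1 unfolding pair_size_def by simp
        then have G: "\<G> = hitting ?X a {C}"
          using sub finite_hitting[OF fX] by (intro card_subset_eq) auto
        then have "C \<in> \<G>" using CX a3 unfolding hitting_def nsets_def by auto
        moreover have "isomorphic_families n ({C} \<union> hitting ?X a {C}) (M_family n a t B)"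
          using CX s 2 by (intro iso) auto
        ultimately show ?thesis using C G by auto
      qed
    qed
  next
    assume iso: "isomorphic_families n (\<F> \<union> \<G>) (M_family n a t B) \<and> (a = b \<longrightarrow> \<F> \<inter> \<G> \<noteq> {})"
    have b0: "0 < b" using num by simp
    note Bf = disjoint_blocks_family[OF B b0]
    let ?B = "B ` {1..t}"
    have cM: "int (card (hitting ?X a ?B)) = sieve_count b t n a"
      using card_hitting_disjoint[OF fX Bf(1) _ Bf(2)] Bf(3) by simp
    obtain \<pi> where \<pi>: "\<pi> permutes ?X" and im: "(`) \<pi> ` \<F> \<union> (`) \<pi> ` \<G> = ?B \<union> hitting ?X a ?B"
      using iso unfolding isomorphic_families_def M_family_eq image_Un by auto
    show "int (card \<F>) + int (card \<G>) = sieve_count b t n a + int t"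
    proof (cases "a = b")
      case False
      have sz: "card S = a" if "S \<in> (`) \<pi> ` \<F> \<union> hitting ?X a ?B" for S
        using that assms(7) nsets_image_permutes[OF \<pi>, of _ a] unfolding hitting_def nsets_def by auto
      have sz': "card S = b" if "S \<in> (`) \<pi> ` \<G> \<union> ?B" for S
        using that assms(8) Bf(1) nsets_image_permutes[OF \<pi>, of _ b] unfolding nsets_def by blast
      have "(`) \<pi> ` \<F> = hitting ?X a ?B \<and> (`) \<pi> ` \<G> = ?B"
        by (rule Un_eq_Un_by_card[OF im sz sz' False])
      then have "card \<F> = card (hitting ?X a ?B)" "card \<G> = t"
        using card_image_permutes[OF \<pi>, of \<F>] card_image_permutes[OF \<pi>, of \<G>] Bf(3) by auto
      then show ?thesis using cM by simp
    next
      case True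
      then have t1: "t = 1" using s num by simp
      \<comment> \<open>For \<open>a = b\<close> the only block hits itself, so the union has
        \<open>card (hitting ?X a ?B)\<close> members. A common member of \<open>\<F>\<close> and
        \<open>\<G>\<close> adds the missing \<open>1\<close>, and \<open>le\<close> excludes
        more.\<close>
      have "?B \<subseteq> hitting ?X a ?B"
        using Bf(1) t1 True b0 unfolding hitting_def nsets_def by auto
      then have "(`) \<pi> ` (\<F> \<union> \<G>) = hitting ?X a ?B" using im unfolding image_Un by auto
      then have "card (\<F> \<union> \<G>) = card (hitting ?X a ?B)"
        using card_image_permutes[OF \<pi>, of "\<F> \<union> \<G>"] by simp
      moreover have "card \<F> + card \<G> = card (\<F> \<union> \<G>) + card (\<F> \<inter> \<G>)"
        by (rule card_Un_Int[OF fF fG])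
      moreover have "1 \<le> card (\<F> \<inter> \<G>)"
        using iso True fF by (simp add: Suc_le_eq card_gt_0_iff)
      ultimately show ?thesis using cM le t1 by linarith
    qed
  qed
  show ?thesis unfolding closed using le eq_iff by blast
qed

end
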